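(* Fix an integer $k\ge0$ and a vector ${\bf x}\in[0,1]^k$ with distinct entries. Suppose the formal series $\sum_{n=0}^\infty\sum_{H\in\mathcal H_{n,k}}a_H\,t_{\bf x}(H,-)$ with real constants $a_H$ has a positive radius of convergence. Then the coefficients $a_H$ for $H\in\bigcup_{n=0}^\infty\mathcal H_{n,k}$ are uniquely determined by the function $F(f):=\sum_{n=0}^\infty\sum_{H\in\mathcal H_{n,k}}a_H\,t_{\bf x}(H,f)$. More precisely, the coefficients $a_H$ can be recovered from the derivatives $d^nF(0;f,\dots,f)$ for $f\in\mathcal W_{\bf p}$ and $n\ge0$.
   Context: $\mathcal W$ is the vector space of bounded symmetric measurable functions $f:[0,1]^2\to\mathbb R$, and $\mathcal W_{[0,1]}$ the set of those with values in $[0,1]$. Multigraphs are finite, undirected, without loops, possibly with multiple edges; an edge $e$ has endpoints $\{e_s,e_t\}$. A $k$-labelled multigraph is a multigraph $H$ with an injective label map $l_H:\{1,\dots,k\}\to V(H)$; isomorphisms must preserve labels. $\mathcal H_{n,k}$ is the finite set of isomorphism classes of $k$-labelled multigraphs with $n$ edges and no unlabelled isolated vertices. With $V_0=V(H)\setminus l_H(\{1,\dots,k\})$, $$t_{\bf x}(H,f)=\int_{[0,1]^{V_0}}\prod_{e\in E(H)}f(x_{e_s},x_{e_t})\prod_{i\in V_0}dx_i,$$ where $x_v={\bf x}_{l_H^{-1}(v)}$ for labelled vertices $v$; the empty product is $1$. The radius of convergence $R$ of $\sum_n\sum_{H\in\mathcal H_{n,k}}a_Ht_{\bf x}(H,-)$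 is given by $R^{-1}=\limsup_{n\to\infty}\left(\sum_{H\in\mathcal H_{n,k}}|a_H|\right)^{1/n}$. The series (summed by increasing $n$) converges absolutely at each $f\in\mathcal W$ with values in $[-s,s]$ for some $s<R$, and $F$ denotes the resulting function on this set of $f$. G\^ateaux derivatives: $dF(f;g)=\lim_{\lambda\to0}\frac1\lambda(F(f+\lambda g)-F(f))$, and inductively $d^nF(f;g_1,\dots,g_n)=\lim_{\lambda\to0}\frac1\lambda(d^{n-1}F(f+\lambda g_n;g_1,\dots,g_{n-1})-d^{n-1}F(f;g_1,\dots,g_{n-1}))$; for $n=0$ the derivative at $0$ is $F(0)$. For integers $1\le a<b\le p$, let $e^p_{(a,b)}$ be the indicator function of $\left(\frac{a-1}p,\frac ap\right]\times\left(\frac{b-1}p,\frac bp\right]$ plus the indicator function of $\left(\frac{b-1}p,\frac bp\right]\times\left(\frac{a-1}p,\frac ap\right]$; $\mathcal W_p=\mathcal W_{[0,1]}\cap\operatorname{span}_{\mathbb R}\{e^p_{(a,b)}:1\le a<b\le p\}$, and $\mathcal W_{\bf p}=\bigcup_{p\ge1}\mathcal W_p$.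
   Formalization: Recovery from derivatives over W_p is stated only when no entry of x is 0, since every f in W_p vanishes when an argument is 0 and the claim fails if some x_i=0; for all x it is stated with 0 added to the first cell. Uniqueness from F holds for all x. *)

theory Defs
  imports "HOL-Analysis.Analysis" "HOL-Library.Multiset" "HOL-Library.FuncSet"
begin

text \<open>Functions on the unit square are total functions on pairs of reals whose values off the
  square are never used. "Measurable" means Borel measurable, so that all the sections
  $f(x_i, -)$ occurring in the integrals below are measurable.\<close>

type_synonym kernel = "real \<times> real \<Rightarrow> real"

abbreviation unit_square :: "(real \<times> real) set" where
  "unit_square \<equiv> {0..1} \<times> {0..1}"

definition kernels :: "kernel set" where
  "kernels = {f. bounded (f ` unit_square) \<and>
     (\<forall>s\<in>{0..1}. \<forall>t\<in>{0..1}. f (s, t) = f (t, s)) \<and>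
     f \<in> borel_measurable (restrict_space borel unit_square)}"

definition kernels01 :: "kernel set" where
  "kernels01 = {f \<in> kernels. \<forall>z\<in>unit_square. f z \<in> {0..1}}"

text \<open>Every finite multigraph is isomorphic to one with natural numbers as vertices. An edge is the
  two-element set of its endpoints, and parallel edges are counted by the multiset. Only the values
  of \<open>label\<close> on \<open>{1..k}\<close> matter.\<close>

record mgraph =
  verts :: "nat set"
  edges :: "nat set multiset"
  label :: "nat \<Rightarrow> nat"

definition labelled_multigraph :: "nat \<Rightarrow> mgraph \<Rightarrow> bool" where
  "labelled_multigraph k G \<longleftrightarrow>
     finite (verts G) \<and>
     (\<forall>e\<in>#edges G. e \<subseteq> verts G \<and> card e = 2) \<and>
     inj_on (label G) {1..k} \<and> label G ` {1..k} \<subseteq> verts G"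

definition unlabelled :: "nat \<Rightarrow> mgraph \<Rightarrow> nat set" where
  "unlabelled k G = verts G - label G ` {1..k}"

definition mgraph_iso :: "nat \<Rightarrow> (mgraph \<times> mgraph) set" where
  "mgraph_iso k = {(G, H). labelled_multigraph k G \<and> labelled_multigraph k H \<and>
     (\<exists>\<phi>. bij_betw \<phi> (verts G) (verts H) \<and>
          image_mset ((`) \<phi>) (edges G) = edges H \<and>
          (\<forall>i\<in>{1..k}. \<phi> (label G i) = label H i))}"

definition mgraph_classes :: "nat \<Rightarrow> nat \<Rightarrow> mgraph set set" where
  "mgraph_classes n k =
     {G. labelled_multigraph k G \<and> size (edges G) = n \<and>
         (\<forall>v\<in>unlabelled k G. \<exists>e\<in>#edges G. v \<in> e)} // mgraph_iso k"

definition vertex_value :: "nat \<Rightarrow> (nat \<Rightarrow> real) \<Rightarrow> mgraph \<Rightarrow> (nat \<Rightarrow> real) \<Rightarrow> nat \<Rightarrow> real" where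
  "vertex_value k x G y v =
     (if v \<in> label G ` {1..k} then x (inv_into {1..k} (label G) v) else y v)"

text \<open>Since \<open>f\<close> is symmetric, it does not matter which endpoint of \<open>e\<close> comes first.\<close>

definition graph_density :: "nat \<Rightarrow> (nat \<Rightarrow> real) \<Rightarrow> mgraph \<Rightarrow> kernel \<Rightarrow> real" where
  "graph_density k x G f =
     (LINT y|PiM (unlabelled k G) (\<lambda>_. restrict_space lborel {0..1}).
        (\<Prod>e\<in>#edges G. f (vertex_value k x G y (Min e), vertex_value k x G y (Max e))))"

text \<open>On an isomorphism class, the common value of the density on its members.\<close>

definition class_density :: "nat \<Rightarrow> (nat \<Rightarrow> real) \<Rightarrow> mgraph set \<Rightarrow> kernel \<Rightarrow> real" where
  "class_density k x H f = the_elem ((\<lambda>G. graph_density k x G f) ` H)"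

text \<open>The library's \<open>conv_radius c\<close> is by definition the inverse in \<open>[0,\<infinity>]\<close> of
  \<open>limsup (\<lambda>n. root n (norm (c n)))\<close>.\<close>

definition series_radius :: "nat \<Rightarrow> (mgraph set \<Rightarrow> real) \<Rightarrow> ereal" where
  "series_radius k a = conv_radius (\<lambda>n. \<Sum>H\<in>mgraph_classes n k. \<bar>a H\<bar>)"

definition series_domain :: "nat \<Rightarrow> (mgraph set \<Rightarrow> real) \<Rightarrow> kernel set" where
  "series_domain k a =
     {f \<in> kernels. \<exists>s. ereal s < series_radius k a \<and> (\<forall>z\<in>unit_square. f z \<in> {-s..s})}"

text \<open>Meaningful on \<open>series_domain k a\<close> only. If \<open>f\<close> lies there and \<open>g\<close> is a kernel, so does
  \<open>f + \<lambda>g\<close> for all small \<open>\<lambda>\<close>; hence the values elsewhere do not affect Gateaux derivatives.\<close>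

definition series_fun :: "nat \<Rightarrow> (nat \<Rightarrow> real) \<Rightarrow> (mgraph set \<Rightarrow> real) \<Rightarrow> kernel \<Rightarrow> real" where
  "series_fun k x a f = (\<Sum>n. \<Sum>H\<in>mgraph_classes n k. a H * class_density k x H f)"

text \<open>\<open>gateaux F n f g\<close> is $d^nF(f; g_1, \ldots, g_n)$. It is given by \<open>Lim\<close>, so it is meaningful only
  if the derivative exists, as expressed by \<open>gateaux_differentiable\<close>.\<close>

primrec gateaux :: "(kernel \<Rightarrow> real) \<Rightarrow> nat \<Rightarrow> kernel \<Rightarrow> (nat \<Rightarrow> kernel) \<Rightarrow> real" where
  "gateaux F 0 f g = F f"
| "gateaux F (Suc n) f g =
     Lim (at 0) (\<lambda>r. (gateaux F n (\<lambda>z. f z + r * g (Suc n) z) g - gateaux F n f g) / r)"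

primrec gateaux_differentiable ::
  "(kernel \<Rightarrow> real) \<Rightarrow> nat \<Rightarrow> kernel \<Rightarrow> (nat \<Rightarrow> kernel) \<Rightarrow> bool" where
  "gateaux_differentiable F 0 f g \<longleftrightarrow> True"
| "gateaux_differentiable F (Suc n) f g \<longleftrightarrow>
     (\<forall>\<^sub>F r in nhds 0. gateaux_differentiable F n (\<lambda>z. f z + r * g (Suc n) z) g) \<and>
     (\<exists>l. ((\<lambda>r. (gateaux F n (\<lambda>z. f z + r * g (Suc n) z) g - gateaux F n f g) / r)
            \<longlongrightarrow> l) (at 0))"

text \<open>Step kernels are taken relative to a family \<open>C\<close> of cells. With the left-open cells no cell
  contains 0, so every step kernel vanishes on the lines $\{0\} \times [0,1]$ and
  $[0,1] \times \{0\}$: if some $x_i = 0$, the density of every graph with an edge at the $i$-th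
  labelled vertex vanishes at all of them, and its coefficient cannot be recovered from them.
  \<open>zero_closed_cell\<close> adds the point 0 to the first cell, so that the cells partition $[0,1]$.\<close>

definition left_open_cell :: "nat \<Rightarrow> nat \<Rightarrow> real set" where
  "left_open_cell p a = {(real a - 1) / real p <.. real a / real p}"

definition zero_closed_cell :: "nat \<Rightarrow> nat \<Rightarrow> real set" where
  "zero_closed_cell p a =
     (if a = 1 then {0 .. 1 / real p} else {(real a - 1) / real p <.. real a / real p})"

definition step_kernel :: "(nat \<Rightarrow> nat \<Rightarrow> real set) \<Rightarrow> nat \<Rightarrow> nat \<Rightarrow> nat \<Rightarrow> kernel" where
  "step_kernel C p a b =
     (\<lambda>z. indicator (C p a \<times> C p b) z + indicator (C p b \<times> C p a) z)"

definition step_kernels01 :: "(nat \<Rightarrow> nat \<Rightarrow> real set) \<Rightarrow> nat \<Rightarrow> kernel set" where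
  "step_kernels01 C p = {f \<in> kernels01. \<exists>c :: nat \<Rightarrow> nat \<Rightarrow> real. \<forall>z\<in>unit_square.
     f z = (\<Sum>(a, b) \<in> {(a, b). 1 \<le> a \<and> a < b \<and> b \<le> p}. c a b * step_kernel C p a b z)}"

definition all_step_kernels01 :: "(nat \<Rightarrow> nat \<Rightarrow> real set) \<Rightarrow> kernel set" where
  "all_step_kernels01 C = (\<Union>p\<in>{1..}. step_kernels01 C p)"

text \<open>One fixed procedure computes the coefficients of every series of positive radius from the
  numbers $d^nF(0; f, \ldots, f)$ with $n \ge 0$ and $f \in S$; the data passed to it is
  \<open>undefined\<close> for \<open>f\<close> outside \<open>S\<close>.\<close>

definition recoverable_from_derivatives :: "nat \<Rightarrow> (nat \<Rightarrow> real) \<Rightarrow> kernel set \<Rightarrow> bool" where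
  "recoverable_from_derivatives k x S \<longleftrightarrow>
     (\<exists>\<Phi> :: (nat \<Rightarrow> kernel \<Rightarrow> real) \<Rightarrow> mgraph set \<Rightarrow> real.
        \<forall>a. series_radius k a > 0 \<longrightarrow>
          (\<forall>n. \<forall>H\<in>mgraph_classes n k.
             a H = \<Phi> (\<lambda>m. \<lambda>f\<in>S. gateaux (series_fun k x a) m (\<lambda>_. 0) (\<lambda>_. f)) H))"

end

theory Submission
  imports Defs "HOL-Probability.Probability"
begin

text \<open>On a step kernel whose value on a pair \<open>e\<close> of cells is \<open>u e ^ j\<close>, the density of \<open>G\<close> is a sum of
  positive weights times \<open>j\<close>-th powers of monomials in the \<open>u e\<close>, one for each extension of the
  labels to a map from the vertices of \<open>G\<close> to the cells. If the \<open>u e\<close> are inverses of distinct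
  primes, distinct monomials have distinct values, so power sums over \<open>j \<ge> 1\<close> isolate the
  coefficient of each monomial. Along a ray from 0 the series becomes a power series whose \<open>n\<close>-th
  coefficient collects the graphs with \<open>n\<close> edges, hence both the function and its derivatives at 0
  determine these density sums.\<close>

section \<open>Power sums and power series\<close>

text \<open>Two obstacles shape the argument. A vertex map may identify vertices, so different
  graphs can produce the same monomial: two disjoint unlabelled edges fold onto a double edge.
  Reading off a monomial therefore isolates a coefficient only in a triangular sense, with graphs
  ordered by their number of unlabelled vertices. Moreover, combinations of the
  \<open>step_kernel\<close> functions vanish on diagonal blocks, so a map sending an edge into a
  single cell has monomial 0. Labelled vertices cannot be moved, their cells being dictated by
  \<open>x\<close>; distinctness of the points and large \<open>p\<close> serve to place them in
  different cells.\<close>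

lemma power_sums_fibre_zero:
  fixes v w :: "'i \<Rightarrow> real"
  assumes fin: "finite I"
    and sums: "\<And>j. j \<ge> 1 \<Longrightarrow> (\<Sum>i\<in>I. w i * v i ^ j) = 0"
    and "c \<noteq> 0"
  shows "(\<Sum>i | i \<in> I \<and> v i = c. w i) = 0"
proof -
  \<comment> \<open>An interpolation polynomial that vanishes at every value other than
    \<open>c\<close>. The factor \<open>[:0, 1:]\<close> removes the constant term, so that only
    power sums with \<open>j \<ge> 1\<close> occur, and \<open>c \<noteq> 0\<close> keeps this
    factor from vanishing at \<open>c\<close>.\<close>
  define q where "q = [:0, 1:] * (\<Prod>d\<in>v ` I - {c}. [:- d, 1:])"
  have q0: "poly q (v i) = 0" if "i \<in> I" "v i \<noteq> c" for i
    using that fin by (auto simp: q_def poly_prod)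
  have qc: "poly q c \<noteq> 0"
    using fin \<open>c \<noteq> 0\<close> by (auto simp: q_def poly_prod)
  have "(\<Sum>i\<in>I. w i * poly q (v i)) = (\<Sum>j\<le>degree q. coeff q j * (\<Sum>i\<in>I. w i * v i ^ j))"
    unfolding poly_altdef sum_distrib_left by (subst sum.swap) (simp add: mult_ac)
  also have "\<dots> = 0"
  proof (rule sum.neutral, safe)
    fix j
    show "coeff q j * (\<Sum>i\<in>I. w i * v i ^ j) = 0"
      by (cases "j = 0") (simp_all add: sums q_def coeff_mult_0)
  qed
  finally have "0 = (\<Sum>i\<in>I. w i * poly q (v i))" ..
  also have "\<dots> = (\<Sum>i | i \<in> I \<and> v i = c. w i * poly q (v i))"
    using fin q0 by (intro sum.mono_neutral_right) auto
  also have "\<dots> = (\<Sum>i | i \<in> I \<and> v i = c. w i) * poly q c"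
    by (simp add: sum_distrib_right)
  finally show ?thesis using qc by simp
qed

text \<open>Unique factorisation makes the values multiplicatively free. Inverses of primes are
  taken, not the primes, so that all values and their powers lie in \<open>[0, 1]\<close>, as the
  kernels in \<open>kernels01\<close> require.\<close>

lemma ex_unit_interval_free_generators:
  assumes "finite A"
  obtains u :: "'a \<Rightarrow> real"
  where "\<And>e. e \<in> A \<Longrightarrow> 0 < u e \<and> u e \<le> 1"
    and "\<And>M N. set_mset M \<subseteq> A \<Longrightarrow> set_mset N \<subseteq> A \<Longrightarrow>
           (\<Prod>e\<in>#M. u e) = (\<Prod>e\<in>#N. u e) \<Longrightarrow> M = N"
proof -
  obtain P where P: "finite P" "card P = card A" "P \<subseteq> {p :: nat. prime p}"
    using infinite_arbitrarily_large[OF primes_infinite] by metis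
  then obtain h where h: "bij_betw h A P"
    using assms finite_same_card_bij by metis
  have hp: "prime (h e)" if "e \<in> A" for e
    using h P that by (auto dest: bij_betwE)
  have prod_inv: "(\<Prod>e\<in>#M. 1 / real (h e)) = 1 / real (\<Prod>e\<in>#M. h e)" for M
    by (induction M) auto
  show thesis
  proof (rule that[of "\<lambda>e. 1 / real (h e)"])
    fix e assume "e \<in> A"
    then show "0 < 1 / real (h e) \<and> 1 / real (h e) \<le> 1"
      using hp[of e] prime_gt_0_nat[of "h e"] by simp
  next
    fix M N assume M: "set_mset M \<subseteq> A" and N: "set_mset N \<subseteq> A"
      and eq: "(\<Prod>e\<in>#M. 1 / real (h e)) = (\<Prod>e\<in>#N. 1 / real (h e))"
    have "prod_mset (image_mset h M) = prod_mset (image_mset h N)"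
      using eq by (simp add: prod_inv)
    then have "prime_factorization (prod_mset (image_mset h M)) =
        prime_factorization (prod_mset (image_mset h N))" by (rule arg_cong)
    moreover have pf: "prime_factorization (prod_mset (image_mset h L)) = image_mset h L"
      if "set_mset L \<subseteq> A" for L
      using that hp by (intro prime_factorization_prod_mset_primes) auto
    ultimately have hh: "image_mset h M = image_mset h N"
      by (simp only: pf[OF M] pf[OF N])
    have inv: "image_mset (inv_into A h) (image_mset h L) = L" if "set_mset L \<subseteq> A" for L
      using that h
      by (induction L) (auto simp: bij_betw_def)
    show "M = N" using inv[OF M] inv[OF N] hh by metis
  qed
qed

text \<open>The identity theorem on the real line, by differentiation: equality on a neighbourhood
  of 0 is inherited by all derivatives, and their values at 0 are the coefficients up to
  factorials.\<close>

lemma eval_fps_eqD_real: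
  fixes f g :: "real fps"
  assumes "fps_conv_radius f > 0" "fps_conv_radius g > 0"
    and "eventually (\<lambda>z. eval_fps f z = eval_fps g z) (nhds 0)"
  shows "f = g"
proof -
  define r where "r = min (fps_conv_radius f) (fps_conv_radius g)"
  have r: "r > 0" using assms by (simp add: r_def)
  have ball: "eventually (\<lambda>z :: real. ereal (norm z) < r) (nhds 0)"
  proof -
    obtain d where "0 < ereal d" "ereal d < r" using ereal_dense2[OF r] by auto
    then show ?thesis
      unfolding eventually_nhds_metric
      by (intro exI[of _ d]) (auto, metis ereal_less(3) less_ereal.simps(1) order_less_trans)
  qed
  have "r \<le> fps_conv_radius ((fps_deriv ^^ n) f) \<and> r \<le> fps_conv_radius ((fps_deriv ^^ n) g) \<and>
      eventually (\<lambda>z. eval_fps ((fps_deriv ^^ n) f) z = eval_fps ((fps_deriv ^^ n) g) z) (nhds 0)" for n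
  proof (induction n)
    case 0
    then show ?case using assms by (simp add: r_def)
  next
    case (Suc n)
    let ?f = "(fps_deriv ^^ n) f" and ?g = "(fps_deriv ^^ n) g"
    \<comment> \<open>A derivative at \<open>z\<close> needs equality near \<open>z\<close>, not
      just at \<open>z\<close>; this holds for all \<open>z\<close> close to 0 because
      neighbourhoods of 0 may be taken open.\<close>
    have "eventually (\<lambda>z. eventually (\<lambda>z. eval_fps ?f z = eval_fps ?g z) (nhds z)) (nhds 0)"
      using Suc.IH by (subst eventually_eventually) auto
    then have "eventually (\<lambda>z. eval_fps (fps_deriv ?f) z = eval_fps (fps_deriv ?g) z) (nhds 0)"
      using ball
    proof eventually_elim
      case (elim z)
      have "(eval_fps ?f has_field_derivative eval_fps (fps_deriv ?f) z) (at z)"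
        using elim Suc.IH by (intro has_field_derivative_eval_fps) auto
      moreover have "(eval_fps ?g has_field_derivative eval_fps (fps_deriv ?g) z) (at z)"
        using elim Suc.IH by (intro has_field_derivative_eval_fps) auto
      ultimately show ?case
        using elim(1) DERIV_cong_ev[OF refl elim(1) refl] DERIV_unique by blast
    qed
    moreover have "r \<le> fps_conv_radius (fps_deriv ?f)" "r \<le> fps_conv_radius (fps_deriv ?g)"
      using Suc.IH fps_conv_radius_deriv order_trans by blast+
    ultimately show ?case by simp
  qed
  then have "eval_fps ((fps_deriv ^^ n) f) 0 = eval_fps ((fps_deriv ^^ n) g) 0" for n
    by (blast dest: eventually_nhds_x_imp_x)
  then show ?thesis
    by (intro fps_ext) (simp add: eval_fps_at_0 fps_0th_higher_deriv)
qed

section \<open>Labelled multigraphs\<close>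

lemma labelled_multigraph_image_subset:
  assumes "labelled_multigraph k G" "i \<in> {1..k}"
  shows "label G i \<in> verts G"
  using assms by (auto simp: labelled_multigraph_def)

lemma image_mset_image_cancel:
  assumes "\<And>e. e \<in># M \<Longrightarrow> e \<subseteq> V" "\<And>v. v \<in> V \<Longrightarrow> g (f v) = v"
  shows "image_mset ((`) g) (image_mset ((`) f) M) = M"
proof -
  have "g ` f ` e = e" if "e \<in># M" for e
    using assms that by (force simp: image_image)
  then have "image_mset (\<lambda>e. g ` f ` e) M = image_mset (\<lambda>e. e) M"
    by (intro image_mset_cong) auto
  then show ?thesis by (simp add: multiset.map_comp comp_def)
qed

lemma equiv_mgraph_iso: "equiv {G. labelled_multigraph k G} (mgraph_iso k)"
proof (intro equivI symI transI refl_onI)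
  show "mgraph_iso k \<subseteq> {G. labelled_multigraph k G} \<times> {G. labelled_multigraph k G}"
    by (auto simp: mgraph_iso_def)
  fix G assume "G \<in> {G. labelled_multigraph k G}"
  then show "(G, G) \<in> mgraph_iso k"
    by (auto simp: mgraph_iso_def intro!: exI[of _ id])
next
  fix G H assume "(G, H) \<in> mgraph_iso k"
  then obtain \<phi> where G: "labelled_multigraph k G" "labelled_multigraph k H"
    and \<phi>: "bij_betw \<phi> (verts G) (verts H)" "image_mset ((`) \<phi>) (edges G) = edges H"
      "\<forall>i\<in>{1..k}. \<phi> (label G i) = label H i"
    by (auto simp: mgraph_iso_def)
  let ?\<psi> = "inv_into (verts G) \<phi>"
  have "image_mset ((`) ?\<psi>) (edges H) = edges G"
    unfolding \<phi>(2)[symmetric] using G \<phi>(1)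
    by (intro image_mset_image_cancel[of _ "verts G"])
      (auto simp: labelled_multigraph_def bij_betw_def)
  moreover have "\<forall>i\<in>{1..k}. ?\<psi> (label H i) = label G i"
    using \<phi> labelled_multigraph_image_subset[OF G(1)]
    by (metis bij_betw_inv_into_left)
  ultimately show "(H, G) \<in> mgraph_iso k"
    using G bij_betw_inv_into[OF \<phi>(1)] by (auto simp: mgraph_iso_def)
next
  fix G H K assume "(G, H) \<in> mgraph_iso k" "(H, K) \<in> mgraph_iso k"
  then obtain \<phi> \<psi> where G: "labelled_multigraph k G" "labelled_multigraph k K"
    and "bij_betw \<phi> (verts G) (verts H)" "image_mset ((`) \<phi>) (edges G) = edges H"
      "\<forall>i\<in>{1..k}. \<phi> (label G i) = label H i"
    and "bij_betw \<psi> (verts H) (verts K)" "image_mset ((`) \<psi>) (edges H) = edges K"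
      "\<forall>i\<in>{1..k}. \<psi> (label H i) = label K i"
    by (auto simp: mgraph_iso_def)
  moreover from this have "bij_betw (\<psi> \<circ> \<phi>) (verts G) (verts K)"
    by (blast intro: bij_betw_trans)
  ultimately have "bij_betw (\<psi> \<circ> \<phi>) (verts G) (verts K)"
    "image_mset ((`) (\<psi> \<circ> \<phi>)) (edges G) = edges K"
    "\<forall>i\<in>{1..k}. (\<psi> \<circ> \<phi>) (label G i) = label K i"
    by (auto simp: multiset.map_comp comp_def image_comp
         simp flip: \<open>image_mset ((`) \<phi>) (edges G) = edges H\<close>
           \<open>image_mset ((`) \<psi>) (edges H) = edges K\<close>)
  then show "(G, K) \<in> mgraph_iso k" using G by (auto simp: mgraph_iso_def)
qed

lemma mgraph_iso_unlabelled:
  assumes "labelled_multigraph k G" "bij_betw \<phi> (verts G) (verts H)"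
    and "\<forall>i\<in>{1..k}. \<phi> (label G i) = label H i"
  shows "bij_betw \<phi> (unlabelled k G) (unlabelled k H)"
proof -
  have "label H ` {1..k} = \<phi> ` label G ` {1..k}"
    using assms(3) by (force simp: image_iff)
  moreover have "label G ` {1..k} \<subseteq> verts G"
    using assms by (simp add: labelled_multigraph_def)
  ultimately show ?thesis
    using assms(2) unfolding unlabelled_def bij_betw_def
    by (metis Diff_subset inj_on_image_set_diff inj_on_subset subset_refl)
qed

definition no_isolated :: "nat \<Rightarrow> mgraph \<Rightarrow> bool" where
  "no_isolated k G \<longleftrightarrow> (\<forall>v\<in>unlabelled k G. \<exists>e\<in>#edges G. v \<in> e)"

text \<open>The quotient gives the edge count and the absence of isolated vertices only for some
  representative. Transport along an isomorphism gives them for every member, so representatives can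
  be chosen freely later.\<close>

lemma mgraph_classes_memD:
  assumes "H \<in> mgraph_classes n k" "G \<in> H"
  shows "labelled_multigraph k G" "size (edges G) = n" "no_isolated k G"
    "H = mgraph_iso k `` {G}"
proof -
  obtain G0 where G0: "labelled_multigraph k G0" "size (edges G0) = n"
      "\<forall>v\<in>unlabelled k G0. \<exists>e\<in>#edges G0. v \<in> e" and H: "H = mgraph_iso k `` {G0}"
    using assms(1) by (auto simp: mgraph_classes_def quotient_def)
  have iso: "(G0, G) \<in> mgraph_iso k" using assms(2) H by simp
  then show "labelled_multigraph k G" by (auto simp: mgraph_iso_def)
  from iso obtain \<phi> where
     \<phi>: "bij_betw \<phi> (verts G0) (verts G)" "image_mset ((`) \<phi>) (edges G0) = edges G"
      "\<forall>i\<in>{1..k}. \<phi> (label G0 i) = label G i"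
    by (auto simp: mgraph_iso_def)
  show "size (edges G) = n" using arg_cong[OF \<phi>(2), of size] G0(2) by simp
  show "no_isolated k G"
    unfolding no_isolated_def
  proof
    fix v assume "v \<in> unlabelled k G"
    then obtain w where "w \<in> unlabelled k G0" "v = \<phi> w"
      using mgraph_iso_unlabelled[OF G0(1) \<phi>(1,3)] by (auto simp: bij_betw_def)
    then show "\<exists>e\<in>#edges G. v \<in> e"
      using G0(3) by (fastforce simp: \<phi>(2)[symmetric])
  qed
  show "H = mgraph_iso k `` {G}"
    using H equiv_class_eq[OF equiv_mgraph_iso iso] by simp
qed

lemma mgraph_classes_nonempty: "H \<in> mgraph_classes n k \<Longrightarrow> \<exists>G. G \<in> H"
  unfolding mgraph_classes_def quotient_def using equiv_class_self[OF equiv_mgraph_iso, of _ k] by blast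

lemma finite_unlabelled: "labelled_multigraph k G \<Longrightarrow> finite (unlabelled k G)"
  by (simp add: labelled_multigraph_def unlabelled_def)

lemma card_Union_mset_le:
  "(\<And>e. e \<in># M \<Longrightarrow> card e = 2) \<Longrightarrow> finite (\<Union>(set_mset M)) \<and> card (\<Union>(set_mset M)) \<le> 2 * size M"
proof (induction M)
  case (add e M)
  have "card e = 2" "finite e" using add.prems by (auto intro: card_ge_0_finite)
  then show ?case using add card_Un_le[of e "\<Union>(set_mset M)"] by auto
qed simp

lemma card_verts_le:
  assumes "labelled_multigraph k G" "no_isolated k G"
  shows "card (verts G) \<le> 2 * size (edges G) + k"
proof -
  let ?E = "\<Union>(set_mset (edges G))"
  have E: "finite ?E" "card ?E \<le> 2 * size (edges G)"
    using assms(1) card_Union_mset_le[of "edges G"] by (auto simp: labelled_multigraph_def)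
  have "verts G \<subseteq> ?E \<union> label G ` {1..k}"
    using assms(2) by (auto simp: no_isolated_def unlabelled_def)
  then have "card (verts G) \<le> card (?E \<union> label G ` {1..k})"
    using E by (intro card_mono) auto
  also have "\<dots> \<le> 2 * size (edges G) + k"
    using E card_image_le[of "{1..k}" "label G"] card_Un_le[of ?E "label G ` {1..k}"] by simp
  finally show ?thesis .
qed

text \<open>Every vertex is labelled or lies on an edge, so there are at most
  \<open>2 * n + k\<close> of them, and each class has a member whose vertices are among the first
  \<open>2 * n + k\<close> naturals.\<close>

lemma finite_mgraph_classes: "finite (mgraph_classes n k)"
proof -
  let ?N = "2 * n + k"
  define T where "T = Pow {..<?N} \<times> multisets_of_size (Pow {..<?N}) n \<times> ({1..k} \<rightarrow>\<^sub>E {..<?N})"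
  have "finite T"
    unfolding T_def by (intro finite_cartesian_product finite_PiE finite_multisets_of_size) auto
  moreover have "mgraph_classes n k \<subseteq>
      (\<lambda>(V, E, l). mgraph_iso k `` {\<lparr>verts = V, edges = E, label = l\<rparr>}) ` T"
  proof
    fix H assume H: "H \<in> mgraph_classes n k"
    then obtain G where G: "G \<in> H" using mgraph_classes_nonempty by blast
    note GH = mgraph_classes_memD[OF H G]
    have "card (verts G) \<le> ?N" using card_verts_le[OF GH(1,3)] GH(2) by simp
    moreover have fin: "finite (verts G)" using GH(1) by (simp add: labelled_multigraph_def)
    ultimately obtain \<phi> where \<phi>: "inj_on \<phi> (verts G)" "\<phi> ` verts G \<subseteq> {..<?N}"
      using card_le_inj[of "verts G" "{..<?N}"] by auto
    \<comment> \<open>Labels are cut down to \<open>{1..k}\<close>: values elsewhere are irrelevant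
      to the graph but would leave infinitely many label functions.\<close>
    define G' where "G' = \<lparr>verts = \<phi> ` verts G, edges = image_mset ((`) \<phi>) (edges G),
      label = (\<lambda>i\<in>{1..k}. \<phi> (label G i))\<rparr>"
    have "card (\<phi> ` e) = card e" if "e \<in># edges G" for e
      using that GH(1) by (intro card_image inj_on_subset[OF \<phi>(1)]) (auto simp: labelled_multigraph_def)
    then have "\<forall>e\<in>#edges G'. e \<subseteq> verts G' \<and> card e = 2"
      using GH(1) by (fastforce simp: G'_def labelled_multigraph_def)
    moreover have "inj_on (label G') {1..k}"
    proof -
      have "inj_on (label G) {1..k}" "label G ` {1..k} \<subseteq> verts G"
        using GH(1) by (simp_all add: labelled_multigraph_def)
      then have "inj_on (\<phi> \<circ> label G) {1..k}"
        by (rule comp_inj_on[OF _ inj_on_subset[OF \<phi>(1)]])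
      then show ?thesis by (simp add: G'_def inj_on_restrict_eq comp_def del: One_nat_def)
    qed
    moreover have "label G' ` {1..k} \<subseteq> verts G'"
      using GH(1) by (auto simp: G'_def labelled_multigraph_def)
    ultimately have "labelled_multigraph k G'"
      using fin by (simp add: labelled_multigraph_def G'_def)
    then have "(G, G') \<in> mgraph_iso k"
      using GH(1) \<phi>(1) unfolding mgraph_iso_def
      by (auto simp: G'_def bij_betw_def intro!: exI[of _ \<phi>])
    then have "H = mgraph_iso k `` {G'}"
      using GH(4) equiv_class_eq[OF equiv_mgraph_iso] by metis
    moreover have "(verts G', edges G', label G') \<in> T"
      using GH(1,2) \<phi>(2) unfolding T_def
      by (auto simp: G'_def multisets_of_size_def labelled_multigraph_def image_subset_iff subset_iff)
    moreover have "G' = \<lparr>verts = verts G', edges = edges G', label = label G'\<rparr>" by simp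
    ultimately show "H \<in> (\<lambda>(V, E, l). mgraph_iso k `` {\<lparr>verts = V, edges = E, label = l\<rparr>}) ` T"
      by (intro image_eqI[of _ _ "(verts G', edges G', label G')"]) (simp_all add: G'_def)
  qed
  ultimately show ?thesis using finite_surj by blast
qed

text \<open>Only \<theta> is assumed injective; counting forces the same for \<psi>. Each unlabelled
  vertex of \<open>G0\<close> lies on an edge, so its image is also hit by \<psi>, necessarily at an
  unlabelled vertex. The bound on the number of unlabelled vertices leaves no room for two of them
  to collide.\<close>

lemma mgraph_iso_if_edge_images_agree:
  assumes G: "labelled_multigraph k G" and G0: "labelled_multigraph k G0" "no_isolated k G0"
    and \<theta>: "inj_on \<theta> (verts G0)"
    and lab: "\<And>i. i \<in> {1..k} \<Longrightarrow> \<psi> (label G i) = \<theta> (label G0 i)"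
    and img: "image_mset ((`) \<psi>) (edges G) = image_mset ((`) \<theta>) (edges G0)"
    and card: "card (unlabelled k G) \<le> card (unlabelled k G0)"
  shows "(G, G0) \<in> mgraph_iso k"
proof -
  let ?U = "unlabelled k G" and ?W = "unlabelled k G0"
  let ?L = "label G ` {1..k}" and ?K = "label G0 ` {1..k}"
  have V: "verts G = ?U \<union> ?L" "?U \<inter> ?L = {}" "verts G0 = ?W \<union> ?K" "?W \<inter> ?K = {}"
    using G G0(1) by (auto simp: unlabelled_def dest: labelled_multigraph_image_subset)
  have fin: "finite ?U" "finite ?W" using finite_unlabelled G G0(1) by auto
  have sub: "\<theta> ` ?W \<subseteq> \<psi> ` ?U"
  proof
    fix y assume "y \<in> \<theta> ` ?W"
    then obtain v where v: "v \<in> ?W" "y = \<theta> v" by auto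
    then obtain e where e: "e \<in># edges G0" "v \<in> e" using G0(2) by (auto simp: no_isolated_def)
    then have "\<theta> ` e \<in># image_mset ((`) \<psi>) (edges G)" unfolding img by auto
    then obtain e' where e': "e' \<in># edges G" "\<theta> ` e = \<psi> ` e'" by auto
    then obtain w where w: "w \<in> e'" "y = \<psi> w" using e v by (metis image_iff)
    have "w \<in> verts G" using G e' w by (auto simp: labelled_multigraph_def)
    \<comment> \<open>A labelled \<open>w\<close> would have the same image as the equally labelled
      vertex of \<open>G0\<close>, which injectivity of \<theta> would then identify with the
      unlabelled \<open>v\<close>.\<close>
    moreover have "w \<notin> ?L"
    proof
      assume "w \<in> ?L"
      then obtain i where i: "i \<in> {1..k}" "w = label G i" by blast
      then have "\<theta> v = \<theta> (label G0 i)" using v w lab by metis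
      then have "v = label G0 i"
        using \<theta> V(3) v i by (auto dest: inj_onD)
      then show False using v i V(4) by auto
    qed
    ultimately show "y \<in> \<psi> ` ?U" using V w by auto
  qed
  have inj0: "inj_on \<theta> ?W"
    by (rule inj_on_subset[OF \<theta>]) (use V(3) in blast)
  have "card (\<theta> ` ?W) = card ?W" using inj0 by (rule card_image)
  moreover have "card (\<theta> ` ?W) \<le> card (\<psi> ` ?U)" using sub fin by (intro card_mono) auto
  moreover have "card (\<psi> ` ?U) \<le> card ?U" using fin by (intro card_image_le)
  ultimately have cards: "card (\<psi> ` ?U) = card ?U" "card (\<theta> ` ?W) = card (\<psi> ` ?U)"
    using card by auto
  have injU: "inj_on \<psi> ?U" using cards(1) fin by (intro eq_card_imp_inj_on) auto
  have imgU: "\<theta> ` ?W = \<psi> ` ?U" using sub cards fin by (intro card_subset_eq) auto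
  have imgL: "\<psi> ` ?L = \<theta> ` ?K" using lab by (force simp: image_iff)
  have injL: "inj_on \<psi> ?L"
  proof (rule inj_onI)
    fix v w assume "v \<in> ?L" "w \<in> ?L" "\<psi> v = \<psi> w"
    then obtain i j where ij: "i \<in> {1..k}" "j \<in> {1..k}" "v = label G i" "w = label G j" by blast
    then have "\<theta> (label G0 i) = \<theta> (label G0 j)" using lab \<open>\<psi> v = \<psi> w\<close> by metis
    then have "label G0 i = label G0 j"
      using \<theta> labelled_multigraph_image_subset[OF G0(1)] ij by (auto dest: inj_onD)
    then have "i = j" using G0(1) ij by (auto simp: labelled_multigraph_def dest: inj_onD)
    then show "v = w" using ij by simp
  qed
  have "\<theta> ` ?W \<inter> \<theta> ` ?K = {}"
    using \<theta> V(3,4) inj_on_image_Int[of \<theta> "verts G0" ?W ?K] by auto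
  then have inj: "inj_on \<psi> (verts G)"
    unfolding V(1) using injU injL imgU imgL by (subst inj_on_Un) blast
  have img_verts: "\<psi> ` verts G = \<theta> ` verts G0"
    unfolding V image_Un using imgU imgL by simp
  \<comment> \<open>Both maps are now injective with the same image, so the isomorphism is \<psi>
    followed by the inverse of \<theta>.\<close>
  let ?\<phi> = "inv_into (verts G0) \<theta> \<circ> \<psi>"
  have "bij_betw ?\<phi> (verts G) (verts G0)"
    using inj img_verts \<theta> bij_betw_inv_into[of \<theta> "verts G0" "\<theta> ` verts G0"]
    by (intro bij_betw_trans[of \<psi> _ "\<theta> ` verts G0"]) (auto simp: bij_betw_def)
  moreover have "image_mset ((`) ?\<phi>) (edges G) = edges G0"
  proof -
    have "image_mset ((`) ?\<phi>) (edges G) =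
        image_mset ((`) (inv_into (verts G0) \<theta>)) (image_mset ((`) \<psi>) (edges G))"
      by (simp add: multiset.map_comp comp_def image_image)
    also have "\<dots> = edges G0"
      unfolding img using G0(1) \<theta>
      by (intro image_mset_image_cancel[of _ "verts G0"]) (auto simp: labelled_multigraph_def)
    finally show ?thesis .
  qed
  moreover have "\<forall>i\<in>{1..k}. ?\<phi> (label G i) = label G0 i"
    using lab labelled_multigraph_image_subset[OF G0(1)] \<theta> by auto
  ultimately show ?thesis using G G0(1) by (auto simp: mgraph_iso_def)
qed

section \<open>Densities\<close>

abbreviation unit_interval_measure :: "real measure" where
  "unit_interval_measure \<equiv> restrict_space lborel {0..1}"

interpretation unit_interval: prob_space unit_interval_measure
  by (rule prob_space_restrict_space) auto

interpretation unit_cube: product_prob_space "\<lambda>_ :: nat. unit_interval_measure" UNIV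
  by unfold_locales

section \<open>Measurability, invariance, scaling and bounds of densities\<close>

lemma kernel_compose_measurable:
  assumes "f \<in> kernels" "a \<in> measurable N unit_interval_measure" "b \<in> measurable N unit_interval_measure"
  shows "(\<lambda>y. f (a y, b y)) \<in> borel_measurable N"
proof -
  have f: "f \<in> borel_measurable (restrict_space borel unit_square)"
    using assms(1) by (simp add: kernels_def)
  have "a \<in> borel_measurable N" "b \<in> borel_measurable N"
    using assms(2,3) by (auto simp: measurable_restrict_space2_iff)
  then have "(\<lambda>y. (a y, b y)) \<in> measurable N borel"
    by (rule borel_measurable_Pair)
  moreover have "(\<lambda>y. (a y, b y)) \<in> space N \<rightarrow> unit_square"
    using measurable_space[OF assms(2)] measurable_space[OF assms(3)] by auto
  ultimately have "(\<lambda>y. (a y, b y)) \<in> measurable N (restrict_space borel unit_square)"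
    by (intro measurable_restrict_space2) auto
  then show ?thesis using f by (rule measurable_compose)
qed

lemma borel_measurable_prod_mset:
  fixes g :: "'e \<Rightarrow> 'a \<Rightarrow> real"
  shows "(\<And>e. e \<in># M \<Longrightarrow> g e \<in> borel_measurable N) \<Longrightarrow>
    (\<lambda>y. \<Prod>e\<in>#M. g e y) \<in> borel_measurable N"
  by (induction M) auto

lemma abs_prod_mset_le_1:
  fixes g :: "'e \<Rightarrow> real"
  shows "(\<And>e. e \<in># M \<Longrightarrow> \<bar>g e\<bar> \<le> 1) \<Longrightarrow> \<bar>\<Prod>e\<in>#M. g e\<bar> \<le> 1"
  by (induction M) (auto simp: abs_mult intro: mult_le_one)

locale unit_points =
  fixes k :: nat and x :: "nat \<Rightarrow> real"
  assumes x_unit: "i \<in> {1..k} \<Longrightarrow> x i \<in> {0..1}"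
begin

lemma vertex_value_label:
  assumes "labelled_multigraph k G" "i \<in> {1..k}"
  shows "vertex_value k x G y (label G i) = x i"
  using assms by (simp add: vertex_value_def labelled_multigraph_def)

lemma vertex_value_unlabelled: "v \<in> unlabelled k G \<Longrightarrow> vertex_value k x G y v = y v"
  by (simp add: vertex_value_def unlabelled_def)

lemma vert_cases:
  assumes "v \<in> verts G"
  obtains (labelled) i where "i \<in> {1..k}" "v = label G i" | (unlabelled) "v \<in> unlabelled k G"
  using assms unfolding unlabelled_def by blast

lemma measurable_vertex_value:
  assumes "labelled_multigraph k G" "v \<in> verts G"
  shows "(\<lambda>y. vertex_value k x G y v) \<in>
    measurable (PiM (unlabelled k G) (\<lambda>_. unit_interval_measure)) unit_interval_measure"
  using assms(2)
proof (cases rule: vert_cases)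
  case (labelled i)
  then show ?thesis using x_unit vertex_value_label[OF assms(1)]
    by (simp add: measurable_const space_restrict_space)
next
  case unlabelled
  then show ?thesis by (simp add: vertex_value_unlabelled)
qed

lemma vertex_value_unit:
  assumes "labelled_multigraph k G" "v \<in> verts G"
    and "y \<in> space (PiM (unlabelled k G) (\<lambda>_. unit_interval_measure))"
  shows "vertex_value k x G y v \<in> {0..1}"
  using measurable_space[OF measurable_vertex_value[OF assms(1,2)] assms(3)]
  by (simp add: space_restrict_space)

lemma edge_verts:
  assumes "labelled_multigraph k G" "e \<in># edges G"
  obtains a b where "e = {a, b}" "a \<in> verts G" "b \<in> verts G" "a < b" "Min e = a" "Max e = b"
proof -
  have "card e = 2" "e \<subseteq> verts G" using assms by (auto simp: labelled_multigraph_def)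
  then obtain c d where "e = {c, d}" "c \<noteq> d" "c \<in> verts G" "d \<in> verts G"
    by (auto simp: card_2_iff)
  then show ?thesis
    using that[of c d] that[of d c] by (cases "c < d") (auto simp: insert_commute)
qed

lemma edge_in_verts:
  assumes "labelled_multigraph k G" "e \<in># edges G"
  shows "Min e \<in> verts G" "Max e \<in> verts G"
  using edge_verts[OF assms] by metis+

lemma measurable_density_integrand:
  assumes "labelled_multigraph k G" "f \<in> kernels"
  shows "(\<lambda>y. \<Prod>e\<in>#edges G. f (vertex_value k x G y (Min e), vertex_value k x G y (Max e))) \<in>
    borel_measurable (PiM (unlabelled k G) (\<lambda>_. unit_interval_measure))"
  using assms
  by (intro borel_measurable_prod_mset kernel_compose_measurable measurable_vertex_value edge_in_verts)

text \<open>A change of variables: renaming coordinates along the bijection of unlabelled vertices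
  preserves the product measure, and labelled vertices keep the value \<open>x i\<close>.\<close>

lemma graph_density_iso:
  assumes "(G, H) \<in> mgraph_iso k" "f \<in> kernels"
  shows "graph_density k x G f = graph_density k x H f"
proof -
  obtain \<phi> where G: "labelled_multigraph k G" "labelled_multigraph k H"
    and \<phi>: "bij_betw \<phi> (verts G) (verts H)" "image_mset ((`) \<phi>) (edges G) = edges H"
      "\<forall>i\<in>{1..k}. \<phi> (label G i) = label H i"
    using assms(1) by (auto simp: mgraph_iso_def)
  let ?U = "unlabelled k G" and ?W = "unlabelled k H" and ?M = "\<lambda>_ :: nat. unit_interval_measure"
  let ?P = "\<lambda>G y. \<Prod>e\<in>#edges G. f (vertex_value k x G y (Min e), vertex_value k x G y (Max e))"
  let ?t = "\<lambda>\<omega>. \<lambda>n\<in>?U. \<omega> (\<phi> n)"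
  have U: "bij_betw \<phi> ?U ?W" by (rule mgraph_iso_unlabelled[OF G(1) \<phi>(1,3)])
  have distr: "distr (PiM ?W ?M) (PiM ?U ?M) ?t = PiM ?U ?M"
    using U by (intro distr_PiM_reindex unit_interval.prob_space_axioms) (auto simp: bij_betw_def)
  have t: "?t \<in> measurable (PiM ?W ?M) (PiM ?U ?M)"
    using U by (intro measurable_restrict measurable_component_singleton) (auto simp: bij_betw_def)
  have "integral\<^sup>L (PiM ?U ?M) (?P G) = integral\<^sup>L (distr (PiM ?W ?M) (PiM ?U ?M) ?t) (?P G)"
    by (simp only: distr)
  also have "\<dots> = (\<integral>\<omega>. ?P G (?t \<omega>) \<partial>PiM ?W ?M)"
    using t measurable_density_integrand[OF G(1) assms(2)] by (rule integral_distr)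
  also have "\<dots> = integral\<^sup>L (PiM ?W ?M) (?P H)"
  proof (rule Bochner_Integration.integral_cong[OF refl])
    fix \<omega> assume \<omega>: "\<omega> \<in> space (PiM ?W ?M)"
    have val: "vertex_value k x H \<omega> (\<phi> v) = vertex_value k x G (?t \<omega>) v" if "v \<in> verts G" for v
      using that
    proof (cases rule: vert_cases)
      case (labelled i)
      then show ?thesis using \<phi>(3) by (simp add: vertex_value_label[OF G(1)] vertex_value_label[OF G(2)])
    next
      case unlabelled
      moreover have "\<phi> v \<in> ?W" using U unlabelled by (auto simp: bij_betw_def)
      ultimately show ?thesis by (simp add: vertex_value_unlabelled)
    qed
    have "f (vertex_value k x G (?t \<omega>) (Min e), vertex_value k x G (?t \<omega>) (Max e)) =
        f (vertex_value k x H \<omega> (Min (\<phi> ` e)), vertex_value k x H \<omega> (Max (\<phi> ` e)))"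
      if e: "e \<in># edges G" for e
    proof -
      obtain a b where ab: "e = {a, b}" "a \<in> verts G" "b \<in> verts G" "Min e = a" "Max e = b"
        using edge_verts[OF G(1) e] by metis
      have img: "\<phi> a \<in> verts H" "\<phi> b \<in> verts H" using \<phi>(1) ab by (auto simp: bij_betw_def)
      have unit: "vertex_value k x H \<omega> (\<phi> a) \<in> {0..1}" "vertex_value k x H \<omega> (\<phi> b) \<in> {0..1}"
        using vertex_value_unit[OF G(2) _ \<omega>] img by auto
      have sym: "f (s, t) = f (t, s)" if "s \<in> {0..1}" "t \<in> {0..1}" for s t
        using assms(2) that by (auto simp: kernels_def)
      have "f (vertex_value k x G (?t \<omega>) (Min e), vertex_value k x G (?t \<omega>) (Max e)) =
          f (vertex_value k x H \<omega> (\<phi> a), vertex_value k x H \<omega> (\<phi> b))"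
        unfolding ab(4,5) val[OF ab(2)] val[OF ab(3)] ..
      \<comment> \<open>The isomorphism need not preserve the order of the endpoints, so
        \<open>Min\<close> and \<open>Max\<close> may be exchanged; symmetry of \<open>f\<close>
        absorbs this.\<close>
      also have "\<dots> = f (vertex_value k x H \<omega> (Min (\<phi> ` e)), vertex_value k x H \<omega> (Max (\<phi> ` e)))"
        unfolding ab(1) using sym[OF unit] by (auto simp: min_def max_def)
      finally show ?thesis .
    qed
    then have "?P G (?t \<omega>) = (\<Prod>e\<in>#edges G. f (vertex_value k x H \<omega> (Min (\<phi> ` e)), vertex_value k x H \<omega> (Max (\<phi> ` e))))"
      by (intro arg_cong[where f = prod_mset] image_mset_cong) blast
    also have "\<dots> = ?P H \<omega>"
      unfolding \<phi>(2)[symmetric] by (simp add: multiset.map_comp comp_def)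
    finally show "?P G (?t \<omega>) = ?P H \<omega>" .
  qed
  finally show ?thesis by (simp add: graph_density_def)
qed

lemma class_density_eq:
  assumes "H \<in> mgraph_classes n k" "G \<in> H" "f \<in> kernels"
  shows "class_density k x H f = graph_density k x G f"
proof -
  have "graph_density k x G' f = graph_density k x G f" if "G' \<in> H" for G'
  proof -
    have "(G, G') \<in> mgraph_iso k" using mgraph_classes_memD(4)[OF assms(1,2)] that by blast
    then show ?thesis using graph_density_iso assms(3) by metis
  qed
  then have "(\<lambda>G. graph_density k x G f) ` H = (\<lambda>_. graph_density k x G f) ` H"
    by (rule image_cong[OF refl])
  then have "(\<lambda>G. graph_density k x G f) ` H = {graph_density k x G f}"
    by (simp only: image_constant[OF assms(2)])
  then show ?thesis by (simp add: class_density_def)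
qed

lemma kernels_scale: "f \<in> kernels \<Longrightarrow> (\<lambda>z. c * f z) \<in> kernels"
  using bounded_scaling[of "f ` unit_square" c]
  by (auto simp: kernels_def image_image)

lemma graph_density_scale:
  "graph_density k x G (\<lambda>z. c * f z) = c ^ size (edges G) * graph_density k x G f"
  by (simp add: graph_density_def prod_mset.distrib)

lemma class_density_scale:
  assumes "H \<in> mgraph_classes n k" "f \<in> kernels"
  shows "class_density k x H (\<lambda>z. c * f z) = c ^ n * class_density k x H f"
proof -
  obtain G where G: "G \<in> H" using mgraph_classes_nonempty[OF assms(1)] by blast
  show ?thesis
    using class_density_eq[OF assms(1) G] assms kernels_scale mgraph_classes_memD(2)[OF assms(1) G]
    by (simp add: graph_density_scale)
qed

lemma abs_graph_density_le_1:
  assumes G: "labelled_multigraph k G" and "f \<in> kernels" "\<And>z. z \<in> unit_square \<Longrightarrow> \<bar>f z\<bar> \<le> 1"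
  shows "\<bar>graph_density k x G f\<bar> \<le> 1"
proof -
  let ?N = "PiM (unlabelled k G) (\<lambda>_. unit_interval_measure)"
  let ?P = "\<lambda>y. \<Prod>e\<in>#edges G. f (vertex_value k x G y (Min e), vertex_value k x G y (Max e))"
  interpret N: prob_space ?N by (intro prob_space_PiM unit_interval.prob_space_axioms)
  have bound: "\<bar>?P y\<bar> \<le> 1" if "y \<in> space ?N" for y
    using vertex_value_unit[OF G _ that] edge_in_verts[OF G]
    by (intro abs_prod_mset_le_1 assms(3)) (auto simp: mem_Times_iff)
  have "\<bar>integral\<^sup>L ?N ?P\<bar> \<le> (\<integral>y. \<bar>?P y\<bar> \<partial>?N)" by (rule integral_abs_bound)
  also have "\<dots> \<le> (\<integral>y. 1 \<partial>?N)"
  proof (rule integral_mono)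
    show "integrable ?N (\<lambda>y. \<bar>?P y\<bar>)"
      using bound measurable_density_integrand[OF G assms(2)]
      by (intro integrable_abs N.integrable_const_bound[where B = 1]) auto
  qed (use bound in auto)
  also have "\<dots> = 1" by (simp add: N.prob_space)
  finally show ?thesis by (simp add: graph_density_def)
qed

section \<open>Densities of step kernels as sums over vertex maps\<close>

definition vertex_cell :: "(real \<Rightarrow> nat) \<Rightarrow> mgraph \<Rightarrow> (nat \<Rightarrow> nat) \<Rightarrow> nat \<Rightarrow> nat" where
  "vertex_cell \<kappa> G \<phi> v =
     (if v \<in> label G ` {1..k} then \<kappa> (x (inv_into {1..k} (label G) v)) else \<phi> v)"

lemma vertex_cell_label:
  assumes "labelled_multigraph k G" "i \<in> {1..k}"
  shows "vertex_cell \<kappa> G \<phi> (label G i) = \<kappa> (x i)"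
  using assms by (simp add: vertex_cell_def labelled_multigraph_def)

text \<open>A weighted homomorphism count: the integrand is constant on each box of points with
  prescribed cells, and the volume of the box is the product of the cell measures. Labelled vertices
  carry no weight, their cells being fixed by \<open>x\<close>.\<close>

lemma graph_density_step:
  fixes u :: "nat set \<Rightarrow> real"
  assumes G: "labelled_multigraph k G"
    and \<kappa>: "\<kappa> \<in> measurable unit_interval_measure (count_space UNIV)" "\<kappa> ` {0..1} \<subseteq> K" "finite K"
    and f: "\<And>s t. s \<in> {0..1} \<Longrightarrow> t \<in> {0..1} \<Longrightarrow> f (s, t) = u {\<kappa> s, \<kappa> t}"
  shows "graph_density k x G f =
    (\<Sum>\<phi> \<in> unlabelled k G \<rightarrow>\<^sub>E K.
       (\<Prod>v\<in>unlabelled k G. measure unit_interval_measure {t \<in> {0..1}. \<kappa> t = \<phi> v}) *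
       (\<Prod>e\<in>#edges G. u (vertex_cell \<kappa> G \<phi> ` e)))"
proof -
  let ?U = "unlabelled k G" and ?M = "\<lambda>_ :: nat. unit_interval_measure"
  let ?N = "PiM ?U ?M"
  let ?Q = "\<lambda>\<phi>. \<Prod>e\<in>#edges G. u (vertex_cell \<kappa> G \<phi> ` e)"
  let ?I = "\<lambda>\<phi> v. indicator {t \<in> {0..1}. \<kappa> t = \<phi> v} :: real \<Rightarrow> real"
  let ?P = "\<lambda>y. \<Prod>e\<in>#edges G. f (vertex_value k x G y (Min e), vertex_value k x G y (Max e))"
  have fin: "finite ?U" using finite_unlabelled[OF G] .
  have finE: "finite (?U \<rightarrow>\<^sub>E K)" using fin \<kappa>(3) by (intro finite_PiE) auto
  have sets: "{t \<in> {0..1}. \<kappa> t = a} \<in> sets unit_interval_measure" for a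
  proof -
    have "\<kappa> -` {a} \<inter> space unit_interval_measure \<in> sets unit_interval_measure"
      by (rule measurable_sets[OF \<kappa>(1)]) simp
    then show ?thesis by (simp add: vimage_def Int_def space_restrict_space conj_commute)
  qed
  have intI: "integrable (?M v) (?I \<phi> v)" for \<phi> v
    using sets by (intro integrable_real_indicator) (auto simp: unit_interval.emeasure_eq_measure)
  \<comment> \<open>Exactly one map, the cell pattern of \<open>y\<close> itself, has a nonzero
    product of indicators. Writing the integrand as a sum over all maps makes each summand factor
    over the coordinates.\<close>
  have expand: "?P y = (\<Sum>\<phi> \<in> ?U \<rightarrow>\<^sub>E K. ?Q \<phi> * (\<Prod>v\<in>?U. ?I \<phi> v (y v)))"
    if y: "y \<in> space ?N" for y
  proof -
    define \<phi> where "\<phi> = (\<lambda>v\<in>?U. \<kappa> (y v))"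
    have yU: "y v \<in> {0..1}" if "v \<in> ?U" for v
      using y that by (auto simp: space_PiM space_restrict_space)
    have \<phi>_in: "\<phi> \<in> ?U \<rightarrow>\<^sub>E K" using yU \<kappa>(2) by (auto simp: \<phi>_def)
    have cell: "\<kappa> (vertex_value k x G y v) = vertex_cell \<kappa> G \<phi> v" if "v \<in> verts G" for v
      using that by (auto simp: vertex_cell_def vertex_value_def \<phi>_def unlabelled_def)
    have "f (vertex_value k x G y (Min e), vertex_value k x G y (Max e)) = u (vertex_cell \<kappa> G \<phi> ` e)"
      if e: "e \<in># edges G" for e
    proof -
      obtain a b where ab: "e = {a, b}" "a \<in> verts G" "b \<in> verts G" "Min e = a" "Max e = b"
        using edge_verts[OF G e] by metis
      show ?thesis unfolding ab(4,5)
        using f[OF vertex_value_unit[OF G ab(2) y] vertex_value_unit[OF G ab(3) y]]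
        by (simp add: cell ab)
    qed
    then have "?P y = ?Q \<phi>"
      by (intro arg_cong[where f = prod_mset] image_mset_cong) blast
    also have "\<dots> = ?Q \<phi> * (\<Prod>v\<in>?U. ?I \<phi> v (y v))"
      using yU by (simp add: \<phi>_def)
    also have "\<dots> = (\<Sum>\<psi> \<in> {\<phi>}. ?Q \<psi> * (\<Prod>v\<in>?U. ?I \<psi> v (y v)))" by simp
    also have "\<dots> = (\<Sum>\<psi> \<in> ?U \<rightarrow>\<^sub>E K. ?Q \<psi> * (\<Prod>v\<in>?U. ?I \<psi> v (y v)))"
    proof (intro sum.mono_neutral_left ballI)
      fix \<psi> assume "\<psi> \<in> (?U \<rightarrow>\<^sub>E K) - {\<phi>}"
      then obtain v where v: "v \<in> ?U" "\<psi> v \<noteq> \<phi> v"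
        using \<phi>_in by (metis DiffE PiE_ext singletonI)
      then have "?I \<psi> v (y v) = 0" by (simp add: \<phi>_def)
      then have "(\<Prod>v\<in>?U. ?I \<psi> v (y v)) = 0" using fin v by (subst prod_zero_iff) blast+
      then show "?Q \<psi> * (\<Prod>v\<in>?U. ?I \<psi> v (y v)) = 0" by simp
    qed (use \<phi>_in finE in auto)
    finally show ?thesis .
  qed
  have int: "integrable ?N (\<lambda>y. \<Prod>v\<in>?U. ?I \<phi> v (y v))" for \<phi>
    by (rule unit_cube.product_integrable_prod[OF fin intI])
  have "graph_density k x G f = (\<integral>y. (\<Sum>\<phi> \<in> ?U \<rightarrow>\<^sub>E K. ?Q \<phi> * (\<Prod>v\<in>?U. ?I \<phi> v (y v))) \<partial>?N)"
    unfolding graph_density_def by (intro Bochner_Integration.integral_cong refl expand)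
  also have "\<dots> = (\<Sum>\<phi> \<in> ?U \<rightarrow>\<^sub>E K. (\<integral>y. ?Q \<phi> * (\<Prod>v\<in>?U. ?I \<phi> v (y v)) \<partial>?N))"
    using int by (intro Bochner_Integration.integral_sum integrable_mult_right)
  also have "\<dots> = (\<Sum>\<phi> \<in> ?U \<rightarrow>\<^sub>E K. ?Q \<phi> * (\<Prod>v\<in>?U. measure unit_interval_measure {t \<in> {0..1}. \<kappa> t = \<phi> v}))"
  proof (rule sum.cong[OF refl])
    fix \<phi>
    have "(\<integral>y. (\<Prod>v\<in>?U. ?I \<phi> v (y v)) \<partial>?N) = (\<Prod>v\<in>?U. integral\<^sup>L (?M v) (?I \<phi> v))"
      by (rule unit_cube.product_integral_prod[OF fin intI])
    also have "\<dots> = (\<Prod>v\<in>?U. measure unit_interval_measure {t \<in> {0..1}. \<kappa> t = \<phi> v})"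
      using sets by (intro prod.cong refl)
        (auto simp: integral_indicator space_restrict_space intro!: arg_cong[where f = "measure _"])
    finally show "(\<integral>y. ?Q \<phi> * (\<Prod>v\<in>?U. ?I \<phi> v (y v)) \<partial>?N) =
        ?Q \<phi> * (\<Prod>v\<in>?U. measure unit_interval_measure {t \<in> {0..1}. \<kappa> t = \<phi> v})"
      by simp
  qed
  finally show ?thesis by (simp add: mult.commute)
qed

section \<open>The series along rays from zero\<close>

definition density_fps :: "(mgraph set \<Rightarrow> real) \<Rightarrow> kernel \<Rightarrow> real fps" where
  "density_fps a f = Abs_fps (\<lambda>n. \<Sum>H\<in>mgraph_classes n k. a H * class_density k x H f)"

text \<open>The density of a graph with \<open>n\<close> edges is homogeneous of degree
  \<open>n\<close>. Both sides are the same \<open>suminf\<close> term by term, so this holds for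
  every \<open>c\<close>, whether or not the series converges.\<close>

lemma series_fun_scale:
  assumes "f \<in> kernels"
  shows "series_fun k x a (\<lambda>z. c * f z) = eval_fps (density_fps a f) c"
  unfolding series_fun_def eval_fps_def density_fps_def
  using assms by (simp add: class_density_scale sum_distrib_left sum_distrib_right mult_ac)

text \<open>Densities of kernels bounded by 1 are at most 1 in absolute value, so the coefficients
  are dominated by the sums of \<open>\<bar>a H\<bar>\<close> that define the radius.\<close>

lemma series_radius_le:
  assumes "f \<in> kernels" "\<And>z. z \<in> unit_square \<Longrightarrow> \<bar>f z\<bar> \<le> 1"
  shows "series_radius k a \<le> fps_conv_radius (density_fps a f)"
  unfolding fps_conv_radius_def series_radius_def
proof (rule conv_radius_geI_ex)
  let ?s = "\<lambda>n. \<Sum>H\<in>mgraph_classes n k. \<bar>a H\<bar>"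
  fix r :: real assume r: "0 < r" "ereal r < conv_radius ?s"
  have "summable (\<lambda>n. norm (fps_nth (density_fps a f) n * of_real r ^ n))"
  proof (rule summable_comparison_test[OF _ abs_summable_in_conv_radius[of r ?s]], intro exI allI impI)
    fix n
    have "\<bar>fps_nth (density_fps a f) n\<bar> \<le> (\<Sum>H\<in>mgraph_classes n k. \<bar>a H * class_density k x H f\<bar>)"
      by (simp add: density_fps_def sum_abs)
    also have "\<dots> \<le> ?s n"
    proof (rule sum_mono)
      fix H assume H: "H \<in> mgraph_classes n k"
      then obtain G where G: "G \<in> H" using mgraph_classes_nonempty by blast
      have "\<bar>class_density k x H f\<bar> \<le> 1"
        using class_density_eq[OF H G assms(1)] abs_graph_density_le_1 assms
          mgraph_classes_memD(1)[OF H G] by simp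
      then show "\<bar>a H * class_density k x H f\<bar> \<le> \<bar>a H\<bar>"
        using mult_left_le[of "\<bar>class_density k x H f\<bar>" "\<bar>a H\<bar>"] by (simp add: abs_mult)
    qed
    finally show "norm (norm (fps_nth (density_fps a f) n * of_real r ^ n)) \<le> norm (?s n * r ^ n)"
      using r by (simp add: abs_mult mult_right_mono sum_nonneg)
  qed (use r in simp)
  then show "\<exists>z. norm z = r \<and> summable (\<lambda>n. fps_nth (density_fps a f) n * z ^ n)"
    using r by (intro exI[of _ r]) (auto intro: summable_rabs_cancel)
qed

end

text \<open>With every direction equal to \<open>f\<close>, iterated derivatives never leave the
  line through 0 and \<open>f\<close>, where \<open>F\<close> is a power series in one variable. The
  claim covers all points within the radius, since each further derivative at \<open>c\<close> needs
  the preceding one near \<open>c\<close>.\<close>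

lemma gateaux_along_ray:
  fixes f :: kernel
  assumes F: "\<And>c. F (\<lambda>z. c * f z) = eval_fps g c"
    and "r \<le> fps_conv_radius g" "ereal \<bar>c\<bar> < r"
  shows "gateaux_differentiable F n (\<lambda>z. c * f z) (\<lambda>_. f) \<and>
    gateaux F n (\<lambda>z. c * f z) (\<lambda>_. f) = eval_fps ((fps_deriv ^^ n) g) c"
  using assms(3)
proof (induction n arbitrary: c)
  case 0
  then show ?case using F by simp
next
  case (Suc n)
  have shift: "(\<lambda>z. c * f z + s * f z) = (\<lambda>z. (c + s) * f z)" for s :: real
    by (simp add: distrib_right)
  have ev: "eventually (\<lambda>s :: real. ereal \<bar>c + s\<bar> < r) (nhds 0)"
  proof -
    obtain d where d: "ereal \<bar>c\<bar> < ereal d" "ereal d < r" using ereal_dense2[OF Suc.prems] by auto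
    have "ereal \<bar>c + s\<bar> < r" if "dist s 0 < d - \<bar>c\<bar>" for s
    proof -
      have "\<bar>c + s\<bar> < d" using that by (simp add: dist_real_def)
      then show ?thesis using d(2) by (metis less_ereal.simps(1) order_less_trans)
    qed
    then show ?thesis
      unfolding eventually_nhds_metric using d(1) by (intro exI[of _ "d - \<bar>c\<bar>"]) auto
  qed
  have radius: "r \<le> fps_conv_radius ((fps_deriv ^^ n) g)" for n
    using assms(2) by (induction n) (auto intro: order_trans[OF _ fps_conv_radius_deriv])
  let ?h = "eval_fps ((fps_deriv ^^ n) g)"
  have "(?h has_field_derivative eval_fps (fps_deriv ((fps_deriv ^^ n) g)) c) (at c)"
    using Suc.prems radius[of n] by (intro has_field_derivative_eval_fps) auto
  then have "((\<lambda>s. (?h (c + s) - ?h c) / s) \<longlongrightarrow> eval_fps ((fps_deriv ^^ Suc n) g) c) (at 0)"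
    by (simp add: DERIV_def)
  moreover have "eventually (\<lambda>s. (?h (c + s) - ?h c) / s =
      (gateaux F n (\<lambda>z. c * f z + s * f z) (\<lambda>_. f) - gateaux F n (\<lambda>z. c * f z) (\<lambda>_. f)) / s) (at 0)"
    using ev Suc.IH[OF Suc.prems] Suc.IH
    by (auto simp: shift eventually_at_filter elim: eventually_mono)
  ultimately have lim: "((\<lambda>s. (gateaux F n (\<lambda>z. c * f z + s * f z) (\<lambda>_. f)
      - gateaux F n (\<lambda>z. c * f z) (\<lambda>_. f)) / s) \<longlongrightarrow> eval_fps ((fps_deriv ^^ Suc n) g) c) (at 0)"
    by (rule Lim_transform_eventually)
  moreover have "eventually (\<lambda>s. gateaux_differentiable F n (\<lambda>z. c * f z + s * f z) (\<lambda>_. f)) (nhds 0)"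
    using ev by eventually_elim (simp add: shift Suc.IH)
  ultimately show ?case
    using tendsto_Lim[OF _ lim] by auto
qed

section \<open>Independence of the densities\<close>

definition vertex_pairs :: "nat \<Rightarrow> nat set set" where
  "vertex_pairs p = {e. e \<subseteq> {1..p} \<and> card e = 2}"

text \<open>Two points in one cell yield a singleton, hence the value 0: this is how the absence of
  diagonal blocks enters. Unordered pairs build in symmetry. Cell number 0, meant for points outside
  all cells, also gives 0.\<close>

definition edge_kernel :: "nat \<Rightarrow> (real \<Rightarrow> nat) \<Rightarrow> (nat set \<Rightarrow> real) \<Rightarrow> kernel" where
  "edge_kernel p \<kappa> u =
     (\<lambda>z. let e = {\<kappa> (fst z), \<kappa> (snd z)} in if e \<in> vertex_pairs p then u e else 0)"

lemma finite_vertex_pairs: "finite (vertex_pairs p)"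
  by (rule finite_subset[of _ "Pow {1..p}"]) (auto simp: vertex_pairs_def)

lemma prod_mset_power:
  fixes g :: "'e \<Rightarrow> 'a :: comm_monoid_mult"
  shows "(\<Prod>e\<in>#M. g e ^ j) = (\<Prod>e\<in>#M. g e) ^ j"
  by (induction M) (auto simp: power_mult_distrib)

context unit_points
begin

text \<open>Index 0 is reserved for points that no cell contains; it may have measure 0, but no
  \<open>x i\<close> may lie there. Positive measure of the other cells keeps weights from
  vanishing, and separation of the \<open>x i\<close> lets the labelled vertices be
  embedded.\<close>

definition separating_cells :: "nat \<Rightarrow> (real \<Rightarrow> nat) \<Rightarrow> bool" where
  "separating_cells p \<kappa> \<longleftrightarrow>
     \<kappa> \<in> measurable unit_interval_measure (count_space UNIV) \<and> \<kappa> ` {0..1} \<subseteq> {0..p} \<and>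
     (\<forall>a\<in>{1..p}. 0 < measure unit_interval_measure {t \<in> {0..1}. \<kappa> t = a}) \<and>
     inj_on (\<lambda>i. \<kappa> (x i)) {1..k} \<and> (\<forall>i\<in>{1..k}. \<kappa> (x i) \<in> {1..p})"

text \<open>What the independence argument asks of a family of kernels, isolated so that both
  conventions for the cells are treated at once. \<open>p\<close> must be arbitrarily large for
  graphs of any size to embed into the cells.\<close>

definition rich :: "kernel set \<Rightarrow> bool" where
  "rich S \<longleftrightarrow> S \<subseteq> kernels01 \<and> (\<forall>N. \<exists>p\<ge>N. \<exists>\<kappa>. separating_cells p \<kappa> \<and>
     (\<forall>u. (\<forall>e\<in>vertex_pairs p. u e \<in> {0..1}) \<longrightarrow> edge_kernel p \<kappa> u \<in> S))"

text \<open>Labelled vertices have prescribed cells, pairwise distinct by separation; the others are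
  spread injectively over the \<open>p - k\<close> cells left.\<close>

lemma ex_vertex_embedding:
  assumes \<kappa>: "separating_cells p \<kappa>" and G: "labelled_multigraph k G" and p: "card (verts G) \<le> p"
  obtains \<phi> where "\<phi> \<in> unlabelled k G \<rightarrow>\<^sub>E {1..p}" "inj_on (vertex_cell \<kappa> G \<phi>) (verts G)"
    "vertex_cell \<kappa> G \<phi> ` verts G \<subseteq> {1..p}"
proof -
  let ?U = "unlabelled k G" and ?R = "(\<lambda>i. \<kappa> (x i)) ` {1..k}"
  have fin: "finite ?U" "finite (verts G)"
    using G finite_unlabelled by (auto simp: labelled_multigraph_def)
  have R: "?R \<subseteq> {1..p}" "card ?R = k" and inj: "inj_on (\<lambda>i. \<kappa> (x i)) {1..k}"
    using \<kappa> by (auto simp: separating_cells_def card_image)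
  have L: "label G ` {1..k} \<subseteq> verts G" "card (label G ` {1..k}) = k"
    using G by (simp_all add: labelled_multigraph_def card_image)
  have "card ?U = card (verts G) - k"
    unfolding unlabelled_def using L fin by (subst card_Diff_subset) auto
  also have "\<dots> \<le> card ({1..p} - ?R)"
    using R p by (subst card_Diff_subset) auto
  finally obtain g where g: "inj_on g ?U" "g ` ?U \<subseteq> {1..p} - ?R"
    using card_le_inj[of ?U "{1..p} - ?R"] fin by auto
  define \<phi> where "\<phi> = restrict g ?U"
  let ?\<psi> = "vertex_cell \<kappa> G \<phi>"
  have \<psi>U: "?\<psi> v = g v" if "v \<in> ?U" for v
    using that by (auto simp: vertex_cell_def \<phi>_def unlabelled_def)
  have \<psi>L: "?\<psi> (label G i) = \<kappa> (x i)" if "i \<in> {1..k}" for i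
    using vertex_cell_label[OF G that] .
  have sep: "?\<psi> v \<noteq> ?\<psi> (label G i)" if "v \<in> ?U" "i \<in> {1..k}" for v i
    unfolding \<psi>U[OF that(1)] \<psi>L[OF that(2)] using g that by (metis DiffE image_eqI subsetD)
  have "inj_on ?\<psi> (verts G)"
  proof (rule inj_onI)
    fix v w assume v: "v \<in> verts G" and w: "w \<in> verts G" and eq: "?\<psi> v = ?\<psi> w"
    show "v = w"
      using v
    proof (cases rule: vert_cases)
      case (labelled i)
      show ?thesis using w
      proof (cases rule: vert_cases)
        case (labelled j)
        then have "\<kappa> (x i) = \<kappa> (x j)"
          using eq \<psi>L \<open>i \<in> {1..k}\<close> \<open>v = label G i\<close> by metis
        then show ?thesis
          using inj labelled \<open>i \<in> {1..k}\<close> \<open>v = label G i\<close> by (auto dest: inj_onD)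
      next
        case unlabelled
        then show ?thesis using sep labelled eq by metis
      qed
    next
      case unlabelled
      show ?thesis using w
      proof (cases rule: vert_cases)
        case (labelled j)
        then show ?thesis using sep unlabelled eq by metis
      next
        case *: unlabelled
        then show ?thesis using \<psi>U unlabelled eq g(1) by (metis inj_onD)
      qed
    qed
  qed
  moreover have "?\<psi> ` verts G \<subseteq> {1..p}"
  proof (rule image_subsetI)
    fix v assume "v \<in> verts G"
    then show "?\<psi> v \<in> {1..p}"
    proof (cases rule: vert_cases)
      case (labelled i)
      then show ?thesis using \<psi>L \<kappa> by (simp add: separating_cells_def)
    next
      case unlabelled
      then show ?thesis using \<psi>U g(2) by (metis DiffE image_subset_iff)
    qed
  qed
  moreover have "\<phi> \<in> ?U \<rightarrow>\<^sub>E {1..p}"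
    using g(2) by (auto simp: \<phi>_def)
  ultimately show thesis using that by blast
qed

text \<open>Among the graphs with nonzero coefficient choose \<open>G\<^sub>0\<close> with the most unlabelled vertices.
  The monomial given by an embedding of \<open>G\<^sub>0\<close> into the cells arises from another graph \<open>G\<close> only if
  \<open>G\<close> maps onto that image; as \<open>G\<close> has no more unlabelled vertices, it is isomorphic to \<open>G\<^sub>0\<close>.\<close>

lemma densities_independent:
  assumes S: "rich S"
    and zero: "\<And>f. f \<in> S \<Longrightarrow> (\<Sum>H\<in>mgraph_classes n k. c H * class_density k x H f) = 0"
    and H: "H \<in> mgraph_classes n k"
  shows "c H = 0"
proof (rule ccontr)
  assume "c H \<noteq> 0"
  define rep :: "mgraph set \<Rightarrow> mgraph" where "rep = (\<lambda>H. SOME G. G \<in> H)"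
  have rep: "rep H \<in> H" if "H \<in> mgraph_classes n k" for H
    unfolding rep_def using mgraph_classes_nonempty[OF that] by (rule someI_ex)
  have graph: "labelled_multigraph k (rep H)" "no_isolated k (rep H)" "H = mgraph_iso k `` {rep H}"
    if "H \<in> mgraph_classes n k" for H
    using mgraph_classes_memD[OF that rep[OF that]] by blast+
  define D where "D = {H \<in> mgraph_classes n k. c H \<noteq> 0}"
  have D: "finite D" "D \<noteq> {}"
    using finite_mgraph_classes H \<open>c H \<noteq> 0\<close> by (auto simp: D_def)
  define size where "size = (\<lambda>H. card (unlabelled k (rep H)))"
  obtain H0 where H0: "H0 \<in> D" "\<And>H. H \<in> D \<Longrightarrow> size H \<le> size H0"
  proof -
    have "Max (size ` D) \<in> size ` D" using D by simp
    then obtain H1 where "H1 \<in> D" "size H1 = Max (size ` D)" by auto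
    then show thesis using that[of H1] D(1) by simp
  qed
  define G0 where "G0 = rep H0"
  have DC: "H \<in> mgraph_classes n k" if "H \<in> D" for H using that by (simp add: D_def)
  have G0: "labelled_multigraph k G0" "no_isolated k G0" "H0 = mgraph_iso k `` {G0}"
    unfolding G0_def using graph DC H0(1) by blast+
  obtain p \<kappa> where p: "card (verts G0) \<le> p" and \<kappa>: "separating_cells p \<kappa>"
    and S\<kappa>: "\<And>u. (\<forall>e\<in>vertex_pairs p. u e \<in> {0..1}) \<Longrightarrow> edge_kernel p \<kappa> u \<in> S"
    using S unfolding rich_def by meson
  obtain \<phi>0 where \<phi>0: "\<phi>0 \<in> unlabelled k G0 \<rightarrow>\<^sub>E {1..p}" and
    \<theta>: "inj_on (vertex_cell \<kappa> G0 \<phi>0) (verts G0)" "vertex_cell \<kappa> G0 \<phi>0 ` verts G0 \<subseteq> {1..p}"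
    using ex_vertex_embedding[OF \<kappa> G0(1) p] by metis
  define \<theta> where "\<theta> = vertex_cell \<kappa> G0 \<phi>0"
  define M where "M = image_mset ((`) \<theta>) (edges G0)"
  have M: "set_mset M \<subseteq> vertex_pairs p"
  proof
    fix e assume "e \<in># M"
    then obtain d where d: "d \<in># edges G0" "e = \<theta> ` d" by (auto simp: M_def)
    then have "d \<subseteq> verts G0" "card d = 2" using G0(1) by (auto simp: labelled_multigraph_def)
    then show "e \<in> vertex_pairs p"
      using \<theta>(2) card_image[OF inj_on_subset[OF \<theta>(1)], of d] d(2)
      by (auto simp: vertex_pairs_def \<theta>_def)
  qed
  obtain u :: "nat set \<Rightarrow> real" where u: "\<And>e. e \<in> vertex_pairs p \<Longrightarrow> 0 < u e \<and> u e \<le> 1"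
    and free: "\<And>M N. set_mset M \<subseteq> vertex_pairs p \<Longrightarrow> set_mset N \<subseteq> vertex_pairs p \<Longrightarrow>
           (\<Prod>e\<in>#M. u e) = (\<Prod>e\<in>#N. u e) \<Longrightarrow> M = N"
    using ex_unit_interval_free_generators[OF finite_vertex_pairs] by metis
  \<comment> \<open>The extension by 0 covers singletons and pairs containing cell 0, so that a
    vertex map sending an edge to such a set contributes the monomial 0.\<close>
  define u0 where "u0 = (\<lambda>e. if e \<in> vertex_pairs p then u e else 0)"
  have u0_prod: "(\<Prod>e\<in>#N. u0 e) = (\<Prod>e\<in>#N. u e)" if "set_mset N \<subseteq> vertex_pairs p" for N
    using that by (intro arg_cong[where f = prod_mset] image_mset_cong) (auto simp: u0_def)
  let ?\<mu> = "\<lambda>a. measure unit_interval_measure {t \<in> {0..1}. \<kappa> t = a}"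
  define I where "I = (SIGMA H:D. unlabelled k (rep H) \<rightarrow>\<^sub>E {0..p})"
  define W where "W = (\<lambda>(H, \<phi>). \<Prod>v\<in>unlabelled k (rep H). ?\<mu> (\<phi> v))"
  define V where "V = (\<lambda>(H, \<phi>). \<Prod>e\<in>#edges (rep H). u0 (vertex_cell \<kappa> (rep H) \<phi> ` e))"
  define v0 where "v0 = (\<Prod>e\<in>#M. u e)"
  have v0: "v0 \<noteq> 0" using M u by (force simp: v0_def)
  have finE: "finite (unlabelled k (rep H) \<rightarrow>\<^sub>E {0..p})" if "H \<in> D" for H
    using finite_unlabelled[OF graph(1)] DC[OF that] by (intro finite_PiE) auto
  have finI: "finite I" unfolding I_def using D finE by (intro finite_SigmaI) auto
  have sums: "(\<Sum>i\<in>I. (c (fst i) * W i) * V i ^ j) = 0" if "j \<ge> 1" for j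
  proof -
    define f where "f = edge_kernel p \<kappa> (\<lambda>e. u e ^ j)"
    have fS: "f \<in> S"
      unfolding f_def using u by (intro S\<kappa>) (auto intro: power_le_one less_imp_le)
    then have fk: "f \<in> kernels" using S by (auto simp: rich_def kernels01_def)
    have "class_density k x H f = (\<Sum>\<phi> \<in> unlabelled k (rep H) \<rightarrow>\<^sub>E {0..p}. W (H, \<phi>) * V (H, \<phi>) ^ j)"
      if "H \<in> D" for H
    proof -
      have "class_density k x H f = graph_density k x (rep H) f"
        using class_density_eq DC[OF that] rep fk by blast
      \<comment> \<open>Here \<open>j \<ge> 1\<close> matters: off the admissible pairs the kernel
        is 0 and so is \<open>u0 e ^ j\<close>, whereas \<open>0 ^ 0\<close> would be 1.\<close>
      also have "\<dots> = (\<Sum>\<phi> \<in> unlabelled k (rep H) \<rightarrow>\<^sub>E {0..p}. (\<Prod>v\<in>unlabelled k (rep H). ?\<mu> (\<phi> v)) *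
          (\<Prod>e\<in>#edges (rep H). u0 (vertex_cell \<kappa> (rep H) \<phi> ` e) ^ j))"
        using \<kappa> \<open>j \<ge> 1\<close>
        by (intro graph_density_step[where u = "\<lambda>e. u0 e ^ j"] graph(1) DC[OF that])
          (auto simp: separating_cells_def f_def edge_kernel_def u0_def Let_def)
      finally show ?thesis by (simp add: W_def V_def prod_mset_power)
    qed
    then have "(\<Sum>H\<in>D. c H * class_density k x H f) =
        (\<Sum>H\<in>D. \<Sum>\<phi> \<in> unlabelled k (rep H) \<rightarrow>\<^sub>E {0..p}. (c H * W (H, \<phi>)) * V (H, \<phi>) ^ j)"
      by (simp add: sum_distrib_left mult.assoc)
    also have "\<dots> = (\<Sum>i\<in>I. (c (fst i) * W i) * V i ^ j)"
      unfolding I_def using D finE by (subst sum.Sigma) (auto intro: sum.cong)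
    finally have "(\<Sum>i\<in>I. (c (fst i) * W i) * V i ^ j) = (\<Sum>H\<in>D. c H * class_density k x H f)" ..
    also have "\<dots> = (\<Sum>H\<in>mgraph_classes n k. c H * class_density k x H f)"
      using finite_mgraph_classes by (intro sum.mono_neutral_left) (auto simp: D_def)
    finally show ?thesis using zero[OF fS] by simp
  qed
  \<comment> \<open>A nonzero monomial has every edge image in \<open>vertex_pairs p\<close>, so
    freeness of \<open>u\<close> turns equality of values into equality of edge multisets, to which
    the counting criterion for isomorphism applies.\<close>
  have fibre: "fst i = H0" if i: "i \<in> I" "V i = v0" for i
  proof -
    obtain H \<phi> where i_eq: "i = (H, \<phi>)" and HD: "H \<in> D" using i by (auto simp: I_def)
    define G where "G = rep H"
    have G: "labelled_multigraph k G" "H = mgraph_iso k `` {G}"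
      unfolding G_def using graph DC HD by blast+
    let ?\<psi> = "vertex_cell \<kappa> G \<phi>"
    have V: "(\<Prod>e\<in>#image_mset ((`) ?\<psi>) (edges G). u0 e) = v0"
      using i(2) by (simp add: V_def i_eq G_def multiset.map_comp comp_def)
    have sub: "set_mset (image_mset ((`) ?\<psi>) (edges G)) \<subseteq> vertex_pairs p"
    proof
      fix e assume "e \<in># image_mset ((`) ?\<psi>) (edges G)"
      then have "u0 e \<noteq> 0" using V v0 by (metis image_eqI prod_mset_zero_iff set_image_mset)
      then show "e \<in> vertex_pairs p" by (auto simp: u0_def split: if_splits)
    qed
    have "image_mset ((`) ?\<psi>) (edges G) = M"
      using free[OF sub M] V unfolding u0_prod[OF sub] v0_def by blast
    then have "(G, G0) \<in> mgraph_iso k"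
      using H0(2)[OF HD] vertex_cell_label[OF G(1)] vertex_cell_label[OF G0(1)] \<theta>(1)
      by (intro mgraph_iso_if_edge_images_agree[OF G(1) G0(1,2), where \<theta> = \<theta> and \<psi> = ?\<psi>])
        (simp_all add: M_def \<theta>_def size_def G_def G0_def)
    then show ?thesis
      using equiv_class_eq[OF equiv_mgraph_iso] G(2) G0(3) i_eq by (metis fst_conv)
  qed
  let ?F = "{i. i \<in> I \<and> V i = v0}"
  have "(\<Sum>i\<in>?F. c (fst i) * W i) = 0"
    by (rule power_sums_fibre_zero[OF finI sums v0])
  moreover have "(\<Sum>i\<in>?F. c (fst i) * W i) = c H0 * (\<Sum>i\<in>?F. W i)"
    unfolding sum_distrib_left using fibre by (intro sum.cong) auto
  \<comment> \<open>Several vertex maps may give this monomial, but nothing cancels: all weights are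
    nonnegative, and that of the embedding \<open>\<phi>0\<close> is positive because it uses only
    cells of positive measure.\<close>
  moreover have "(\<Sum>i\<in>?F. W i) > 0"
  proof (rule sum_pos2[of _ "(H0, \<phi>0)"])
    show "finite ?F" using finI by simp
    have "(H0, \<phi>0) \<in> I"
      using \<phi>0 H0(1) unfolding I_def G0_def[symmetric] by (auto simp: PiE_iff G0_def)
    moreover have "V (H0, \<phi>0) = v0"
      using u0_prod[OF M] by (simp add: V_def v0_def M_def \<theta>_def G0_def multiset.map_comp comp_def)
    ultimately show "(H0, \<phi>0) \<in> ?F" by simp
    show "0 < W (H0, \<phi>0)"
      using \<kappa> \<phi>0 by (auto simp: W_def G0_def separating_cells_def intro!: prod_pos)
    show "0 \<le> W i" if "i \<in> ?F" for i
      by (auto simp: W_def split_def intro!: prod_nonneg)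
  qed
  ultimately have "c H0 = 0" by simp
  then show False using H0(1) by (simp add: D_def)
qed

section \<open>Coefficients from the function and from its derivatives at zero\<close>

lemma coefficients_determined:
  assumes "rich S" "\<And>f. f \<in> S \<Longrightarrow> density_fps a f = density_fps b f" "H \<in> mgraph_classes n k"
  shows "a H = b H"
proof -
  have "a H - b H = 0"
  proof (rule densities_independent[OF assms(1) _ assms(3), where c = "\<lambda>H. a H - b H"])
    fix f assume "f \<in> S"
    then have "fps_nth (density_fps a f) n = fps_nth (density_fps b f) n" using assms(2) by simp
    then show "(\<Sum>H\<in>mgraph_classes n k. (a H - b H) * class_density k x H f) = 0"
      by (simp add: density_fps_def left_diff_distrib sum_subtractf)
  qed
  then show ?thesis by simp
qed

lemma kernels01_abs_le_1: "f \<in> kernels01 \<Longrightarrow> z \<in> unit_square \<Longrightarrow> \<bar>f z\<bar> \<le> 1"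
  by (auto simp: kernels01_def)

lemma kernels01_kernels: "f \<in> kernels01 \<Longrightarrow> f \<in> kernels"
  by (simp add: kernels01_def)

lemma gateaux_series_fun:
  assumes "series_radius k a > 0" "f \<in> kernels01"
  shows "gateaux_differentiable (series_fun k x a) n (\<lambda>_. 0) (\<lambda>_. f)"
    and "gateaux (series_fun k x a) n (\<lambda>_. 0) (\<lambda>_. f) = fact n * fps_nth (density_fps a f) n"
proof -
  \<comment> \<open>The zero kernel is written as the point \<open>c = 0\<close> of the ray through
    \<open>f\<close>.\<close>
  have "gateaux_differentiable (series_fun k x a) n (\<lambda>z. 0 * f z) (\<lambda>_. f) \<and>
      gateaux (series_fun k x a) n (\<lambda>z. 0 * f z) (\<lambda>_. f) =
      eval_fps ((fps_deriv ^^ n) (density_fps a f)) 0"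
    using assms series_fun_scale[OF kernels01_kernels]
    by (intro gateaux_along_ray[OF _ series_radius_le])
      (auto simp: kernels01_kernels kernels01_abs_le_1 simp flip: zero_ereal_def)
  then show "gateaux_differentiable (series_fun k x a) n (\<lambda>_. 0) (\<lambda>_. f)"
    and "gateaux (series_fun k x a) n (\<lambda>_. 0) (\<lambda>_. f) = fact n * fps_nth (density_fps a f) n"
    by (simp_all add: eval_fps_at_0 fps_0th_higher_deriv)
qed

lemma coefficients_determined_by_series_fun:
  assumes "rich S" "series_radius k a > 0" "series_radius k b > 0"
    and eq: "\<And>f. f \<in> series_domain k a \<inter> series_domain k b \<Longrightarrow> series_fun k x a f = series_fun k x b f"
    and "H \<in> mgraph_classes n k"
  shows "a H = b H"
proof (rule coefficients_determined[OF assms(1) _ assms(5)])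
  fix f assume "f \<in> S"
  then have f: "f \<in> kernels01" using assms(1) by (auto simp: rich_def)
  \<comment> \<open>Agreement is assumed only on the common domain. With \<open>r\<close> below both
    radii, the multiples \<open>s * f\<close> with \<open>\<bar>s\<bar> < r\<close> lie in it,
    because \<open>f\<close> is bounded by 1.\<close>
  obtain r where r: "0 < ereal r" "ereal r < series_radius k a" "ereal r < series_radius k b"
    using ereal_dense2[of 0 "min (series_radius k a) (series_radius k b)"] assms(2,3) by auto
  show "density_fps a f = density_fps b f"
  proof (rule eval_fps_eqD_real)
    show "fps_conv_radius (density_fps a f) > 0" "fps_conv_radius (density_fps b f) > 0"
      using assms(2,3) series_radius_le f kernels01_kernels kernels01_abs_le_1
      by (metis less_le_trans)+
    show "eventually (\<lambda>s. eval_fps (density_fps a f) s = eval_fps (density_fps b f) s) (nhds 0)"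
      unfolding eventually_nhds_metric
    proof (intro exI conjI allI impI)
      show "0 < r" using r by simp
      fix s :: real assume "dist s 0 < r"
      then have s: "\<bar>s\<bar> < r" by simp
      have "\<bar>s * f z\<bar> \<le> r" if "z \<in> unit_square" for z
        using s kernels01_abs_le_1[OF f that] mult_mono[of "\<bar>s\<bar>" r "\<bar>f z\<bar>" 1] by (simp add: abs_mult)
      then have "\<forall>z\<in>unit_square. s * f z \<in> {-r..r}"
        by (auto simp: abs_le_iff minus_le_iff)
      then have "(\<lambda>z. s * f z) \<in> series_domain k a \<inter> series_domain k b"
        using r kernels_scale[OF kernels01_kernels[OF f]] unfolding series_domain_def by blast
      then show "eval_fps (density_fps a f) s = eval_fps (density_fps b f) s"
        using eq series_fun_scale[OF kernels01_kernels[OF f]] by metis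
    qed
  qed
qed

text \<open>Uniqueness already yields a procedure: from given data choose any series of positive
  radius having these derivatives. The choice need not return \<open>a\<close> itself, but it agrees
  with \<open>a\<close> on all classes.\<close>

lemma recoverable_if_rich:
  assumes "rich S"
  shows "recoverable_from_derivatives k x S"
proof -
  let ?data = "\<lambda>a m. \<lambda>f\<in>S. gateaux (series_fun k x a) m (\<lambda>_. 0) (\<lambda>_. f)"
  define \<Phi> where "\<Phi> = (\<lambda>d. SOME a. series_radius k a > 0 \<and> ?data a = d)"
  have "a H = \<Phi> (?data a) H" if a: "series_radius k a > 0" and H: "H \<in> mgraph_classes n k" for a n H
  proof -
    have b: "series_radius k (\<Phi> (?data a)) > 0 \<and> ?data (\<Phi> (?data a)) = ?data a"
      unfolding \<Phi>_def using a by (intro someI_ex[of "\<lambda>b. series_radius k b > 0 \<and> ?data b = ?data a"]) blast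
    show ?thesis
    proof (rule coefficients_determined[OF assms _ H])
      fix f assume f: "f \<in> S"
      then have f01: "f \<in> kernels01" using assms by (auto simp: rich_def)
      show "density_fps a f = density_fps (\<Phi> (?data a)) f"
      proof (rule fps_ext)
        fix m
        have "?data a m f = ?data (\<Phi> (?data a)) m f" using b by metis
        then show "fps_nth (density_fps a f) m = fps_nth (density_fps (\<Phi> (?data a)) f) m"
          using f gateaux_series_fun(2)[OF _ f01] a b by simp
      qed
    qed
  qed
  then show ?thesis unfolding recoverable_from_derivatives_def by blast
qed

end

section \<open>Step kernels\<close>

text \<open>\<open>cell_index b p s\<close> is the number of the cell of \<open>s\<close>: of the left-open cell if \<open>b = 0\<close>, with
  value 0 for \<open>s = 0\<close>, and of the cell with 0 added to the first one if \<open>b = 1\<close>.\<close>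

definition cell_index :: "nat \<Rightarrow> nat \<Rightarrow> real \<Rightarrow> nat" where
  "cell_index b p s = max b (nat \<lceil>real p * s\<rceil>)"

lemma cell_index_measurable: "cell_index b p \<in> measurable borel (count_space UNIV)"
  unfolding cell_index_def by measurable

lemma nat_ceiling_eq_iff:
  assumes "p \<ge> 1" "a \<ge> 1"
  shows "nat \<lceil>real p * s\<rceil> = a \<longleftrightarrow> (real a - 1) / real p < s \<and> s \<le> real a / real p"
proof -
  have "nat \<lceil>real p * s\<rceil> = a \<longleftrightarrow> \<lceil>real p * s\<rceil> = int a"
    using assms by auto
  also have "\<dots> \<longleftrightarrow> real a - 1 < real p * s \<and> real p * s \<le> real a"
    by (simp add: ceiling_eq_iff)
  also have "\<dots> \<longleftrightarrow> (real a - 1) / real p < s \<and> s \<le> real a / real p"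
    using assms by (simp add: field_simps)
  finally show ?thesis .
qed

lemma left_open_cell_iff:
  assumes "p \<ge> 1" "a \<ge> 1"
  shows "s \<in> left_open_cell p a \<longleftrightarrow> cell_index 0 p s = a"
  using nat_ceiling_eq_iff[OF assms] by (simp add: left_open_cell_def cell_index_def)

lemma zero_closed_cell_iff:
  assumes "p \<ge> 1" "a \<ge> 1" "s \<ge> 0"
  shows "s \<in> zero_closed_cell p a \<longleftrightarrow> cell_index 1 p s = a"
proof (cases "a = 1")
  case True
  have "max 1 m = 1 \<longleftrightarrow> m \<le> 1" for m :: nat by auto
  then have "cell_index 1 p s = 1 \<longleftrightarrow> nat \<lceil>real p * s\<rceil> \<le> 1"
    by (simp only: cell_index_def)
  also have "\<dots> \<longleftrightarrow> s \<le> 1 / real p"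
    using assms by (simp add: nat_le_iff ceiling_le_iff field_simps)
  finally show ?thesis using True assms by (simp add: zero_closed_cell_def)
next
  case False
  then have "cell_index 1 p s = a \<longleftrightarrow> nat \<lceil>real p * s\<rceil> = a"
    using assms(2) by (auto simp: cell_index_def max_def)
  then show ?thesis using False nat_ceiling_eq_iff[OF assms(1,2)] by (simp add: zero_closed_cell_def)
qed

lemma edge_kernel_step_kernels01:
  assumes \<kappa>: "\<kappa> \<in> measurable borel (count_space UNIV)"
    and cell: "\<And>a s. a \<in> {1..p} \<Longrightarrow> s \<in> {0..1} \<Longrightarrow> s \<in> C p a \<longleftrightarrow> \<kappa> s = a"
    and u: "\<forall>e\<in>vertex_pairs p. u e \<in> {0..1}"
  shows "edge_kernel p \<kappa> u \<in> step_kernels01 C p"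
proof -
  let ?f = "edge_kernel p \<kappa> u"
  have val: "?f z \<in> {0..1}" for z
    using u by (auto simp: edge_kernel_def Let_def)
  have \<kappa>_fst: "(\<lambda>z :: real \<times> real. \<kappa> (fst z)) \<in> measurable borel (count_space UNIV)"
    and \<kappa>_snd: "(\<lambda>z :: real \<times> real. \<kappa> (snd z)) \<in> measurable borel (count_space UNIV)"
    by (auto intro: measurable_compose[OF _ \<kappa>] simp flip: borel_prod)
  \<comment> \<open>Cell numbers form a countable set, so joint measurability reduces to fixing the
    second number and varying the first.\<close>
  define g where "g = (\<lambda>a b :: nat. if {a, b} \<in> vertex_pairs p then u {a, b} else 0)"
  have "(\<lambda>z :: real \<times> real. g (\<kappa> (fst z)) b) \<in> borel_measurable borel" for b
    using measurable_compose[OF \<kappa>_fst, of "\<lambda>a. g a b" borel] by simp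
  then have "(\<lambda>z :: real \<times> real. g (\<kappa> (fst z)) (\<kappa> (snd z))) \<in> borel_measurable borel"
    by (rule measurable_compose_countable[OF _ \<kappa>_snd])
  then have "?f \<in> borel_measurable borel"
    by (simp add: edge_kernel_def g_def Let_def)
  then have "?f \<in> borel_measurable (restrict_space borel unit_square)"
    by (rule measurable_restrict_space1)
  moreover have "bounded (?f ` unit_square)"
    using val by (intro boundedI[of _ 1]) auto
  moreover have "?f (s, t) = ?f (t, s)" for s t
    by (simp add: edge_kernel_def insert_commute)
  ultimately have "?f \<in> kernels01" using val by (auto simp: kernels01_def kernels_def)
  moreover have "?f z = (\<Sum>(a, b) \<in> {(a, b). 1 \<le> a \<and> a < b \<and> b \<le> p}. u {a, b} * step_kernel C p a b z)"
    if z: "z \<in> unit_square" for z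
  proof -
    let ?A = "{(a, b). 1 \<le> a \<and> a < b \<and> b \<le> p}"
    define s t where "s = \<kappa> (fst z)" and "t = \<kappa> (snd z)"
    have finA: "finite ?A" by (rule finite_subset[of _ "{1..p} \<times> {1..p}"]) auto
    \<comment> \<open>At most one pair contributes at \<open>z\<close>: the cell numbers of its
      coordinates in increasing order. The condition \<open>a < b\<close> also keeps the two
      indicators in \<open>step_kernel\<close> from both being 1.\<close>
    have term_eq: "u {a, b} * step_kernel C p a b z = (if (min s t, max s t) = (a, b) then u {a, b} else 0)"
      if "(a, b) \<in> ?A" for a b
    proof -
      have ab: "a \<in> {1..p}" "b \<in> {1..p}" "a < b" using that by auto
      have "fst z \<in> C p a \<longleftrightarrow> s = a" "fst z \<in> C p b \<longleftrightarrow> s = b"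
        "snd z \<in> C p a \<longleftrightarrow> t = a" "snd z \<in> C p b \<longleftrightarrow> t = b"
        using cell ab z by (auto simp: s_def t_def)
      then show ?thesis using ab(3)
        by (auto simp: step_kernel_def indicator_def mem_Times_iff min_def max_def)
    qed
    have pairs: "{s, t} \<in> vertex_pairs p \<longleftrightarrow> (min s t, max s t) \<in> ?A"
      by (auto simp: vertex_pairs_def min_def max_def card_2_iff doubleton_eq_iff)
    have mm: "{min s t, max s t} = {s, t}" by (auto simp: min_def max_def)
    have "(\<Sum>(a, b)\<in>?A. u {a, b} * step_kernel C p a b z) =
        (\<Sum>i\<in>?A. if (min s t, max s t) = i then u {fst i, snd i} else 0)"
    proof (rule sum.cong[OF refl])
      fix i assume "i \<in> ?A"
      then show "(case i of (a, b) \<Rightarrow> u {a, b} * step_kernel C p a b z) =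
          (if (min s t, max s t) = i then u {fst i, snd i} else 0)"
        using term_eq[of "fst i" "snd i"] by (cases i) simp
    qed
    also have "\<dots> = (if (min s t, max s t) \<in> ?A then u {min s t, max s t} else 0)"
      using sum.delta'[OF finA, of "(min s t, max s t)" "\<lambda>i. u {fst i, snd i}"] by simp
    also have "\<dots> = ?f z"
      unfolding pairs[symmetric] mm by (simp add: edge_kernel_def s_def t_def Let_def)
    finally show ?thesis by simp
  qed
  ultimately show ?thesis
    unfolding step_kernels01_def by (intro CollectI conjI exI[of _ "\<lambda>a b. u {a, b}"] ballI)
qed

context unit_points
begin

text \<open>Two points with the same cell number are at most \<open>1 / p\<close> apart, hence the
  spacing hypothesis. The numbers of the \<open>x i\<close> must be positive: for
  \<open>b = 1\<close> this is built in, and for \<open>b = 0\<close> only the point 0 of the unit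
  interval has number 0.\<close>

lemma separating_cells_cell_index:
  assumes b: "b \<le> 1" "b = 0 \<Longrightarrow> \<forall>i\<in>{1..k}. x i \<noteq> 0" and p: "p \<ge> 1"
    and sep: "\<And>i j. i \<in> {1..k} \<Longrightarrow> j \<in> {1..k} \<Longrightarrow> i \<noteq> j \<Longrightarrow> 1 < real p * \<bar>x i - x j\<bar>"
  shows "separating_cells p (cell_index b p)"
  unfolding separating_cells_def
proof (intro conjI ballI)
  let ?\<kappa> = "cell_index b p"
  show \<kappa>: "?\<kappa> \<in> measurable unit_interval_measure (count_space UNIV)"
    using cell_index_measurable by (intro measurable_restrict_space1) simp
  have range: "?\<kappa> s \<in> {0..p}" if "s \<in> {0..1}" for s
    using that b(1) p by (auto simp: cell_index_def nat_le_iff ceiling_le_iff mult_left_le)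
  then show "?\<kappa> ` {0..1} \<subseteq> {0..p}" by blast
  show "0 < measure unit_interval_measure {t \<in> {0..1}. ?\<kappa> t = a}" if a: "a \<in> {1..p}" for a
  proof -
    let ?J = "{(real a - 1) / real p <.. real a / real p}"
    have J: "?J \<subseteq> {0..1}"
    proof -
      have "0 \<le> (real a - 1) / real p" "real a / real p \<le> 1" using a p by (simp_all add: divide_le_eq)
      then show ?thesis by auto
    qed
    \<comment> \<open>Inclusion covers both conventions: for \<open>b = 1\<close> the first cell
      also contains 0.\<close>
    have sub: "?J \<subseteq> {t \<in> {0..1}. ?\<kappa> t = a}"
    proof
      fix t assume t: "t \<in> ?J"
      then have "nat \<lceil>real p * t\<rceil> = a" using nat_ceiling_eq_iff[OF p, of a t] a by simp
      then show "t \<in> {t \<in> {0..1}. ?\<kappa> t = a}" using J t a b(1) by (auto simp: cell_index_def)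
    qed
    have "?\<kappa> -` {a} \<inter> space unit_interval_measure \<in> sets unit_interval_measure"
      by (rule measurable_sets[OF \<kappa>]) simp
    then have sets: "{t \<in> {0..1}. ?\<kappa> t = a} \<in> sets unit_interval_measure"
      by (simp add: vimage_def Int_def space_restrict_space conj_commute)
    have "0 < 1 / real p" using p by simp
    also have "1 / real p = measure lborel ?J"
      using p by (simp add: divide_right_mono diff_divide_distrib)
    also have "\<dots> = measure unit_interval_measure ?J"
      using J by (simp add: measure_restrict_space)
    also have "\<dots> \<le> measure unit_interval_measure {t \<in> {0..1}. ?\<kappa> t = a}"
      by (rule unit_interval.finite_measure_mono[OF sub sets])
    finally show ?thesis .
  qed
  \<comment> \<open>The left inequality is not strict, so that it also holds for the point 0 when
    \<open>b = 1\<close> gives it number 1.\<close>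
  have near: "real (?\<kappa> s) - 1 \<le> real p * s \<and> real p * s \<le> real (?\<kappa> s)" if "s \<in> {0..1}" for s
  proof -
    have ps: "0 \<le> real p * s" using that by simp
    define m where "m = nat \<lceil>real p * s\<rceil>"
    have "real m - 1 \<le> real p * s" "real p * s \<le> real m"
      unfolding m_def using ps by linarith+
    moreover have "?\<kappa> s = max b m" by (simp add: cell_index_def m_def)
    ultimately show ?thesis using b(1) ps by (auto simp: max_def)
  qed
  show "inj_on (\<lambda>i. ?\<kappa> (x i)) {1..k}"
  proof (rule inj_onI, rule ccontr)
    fix i j assume ij: "i \<in> {1..k}" "j \<in> {1..k}" "?\<kappa> (x i) = ?\<kappa> (x j)" "i \<noteq> j"
    have "\<bar>real p * x i - real p * x j\<bar> \<le> 1"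
      using near[OF x_unit[OF ij(1)]] near[OF x_unit[OF ij(2)]] ij(3) by linarith
    then have "real p * \<bar>x i - x j\<bar> \<le> 1"
      by (simp add: abs_mult flip: right_diff_distrib)
    then show False using sep[OF ij(1,2,4)] by linarith
  qed
  show "?\<kappa> (x i) \<in> {1..p}" if i: "i \<in> {1..k}" for i
  proof -
    have "1 \<le> ?\<kappa> (x i)"
    proof (cases "b = 0")
      case True
      then have "0 < x i" using b(2) i x_unit[OF i] by fastforce
      then have "0 < real p * x i" using p by simp
      then show ?thesis by (simp add: cell_index_def le_max_iff_disj Suc_le_eq)
    next
      case False
      then show ?thesis by (simp add: cell_index_def)
    qed
    then show ?thesis using range[OF x_unit[OF i]] by simp
  qed
qed

lemma rich_all_step_kernels01:
  assumes "inj_on x {1..k}" "b \<le> 1" "b = 0 \<Longrightarrow> \<forall>i\<in>{1..k}. x i \<noteq> 0"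
    and cell: "\<And>p a s. p \<ge> 1 \<Longrightarrow> a \<ge> 1 \<Longrightarrow> s \<ge> 0 \<Longrightarrow> s \<in> C p a \<longleftrightarrow> cell_index b p s = a"
  shows "rich (all_step_kernels01 C)"
  unfolding rich_def
proof (intro conjI allI)
  show "all_step_kernels01 C \<subseteq> kernels01"
    by (auto simp: all_step_kernels01_def step_kernels01_def)
  fix N :: nat
  \<comment> \<open>Finitely many distinct points have positive mutual distances, so every large
    \<open>p\<close> separates them; this combines with any lower bound \<open>N\<close>.\<close>
  have "eventually (\<lambda>p. \<forall>i\<in>{1..k}. \<forall>j\<in>{1..k}. i \<noteq> j \<longrightarrow> 1 < real p * \<bar>x i - x j\<bar>) sequentially"
  proof (intro eventually_ball_finite ballI finite_atLeastAtMost)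
    fix i j assume ij: "i \<in> {1..k}" "j \<in> {1..k}"
    show "eventually (\<lambda>p. i \<noteq> j \<longrightarrow> 1 < real p * \<bar>x i - x j\<bar>) sequentially"
    proof (cases "i = j")
      case False
      then have pos: "0 < \<bar>x i - x j\<bar>" using ij assms(1) by (auto dest: inj_onD)
      have "eventually (\<lambda>p. 1 / \<bar>x i - x j\<bar> < real p) sequentially"
        using filterlim_real_sequentially unfolding filterlim_at_top_dense by blast
      then show ?thesis by eventually_elim (use pos in \<open>simp add: field_simps\<close>)
    qed simp
  qed
  then obtain N' where N': "\<And>p i j. p \<ge> N' \<Longrightarrow> i \<in> {1..k} \<Longrightarrow> j \<in> {1..k} \<Longrightarrow> i \<noteq> j \<Longrightarrow>
      1 < real p * \<bar>x i - x j\<bar>"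
    unfolding eventually_sequentially by blast
  define p where "p = max 1 (max N N')"
  have p: "p \<ge> 1" "p \<ge> N" "p \<ge> N'" by (auto simp: p_def)
  have "separating_cells p (cell_index b p)"
    using separating_cells_cell_index[OF assms(2,3) p(1)] N' p(3) by blast
  moreover have "edge_kernel p (cell_index b p) u \<in> all_step_kernels01 C"
    if "\<forall>e\<in>vertex_pairs p. u e \<in> {0..1}" for u
  proof -
    have "edge_kernel p (cell_index b p) u \<in> step_kernels01 C p"
      by (rule edge_kernel_step_kernels01[OF cell_index_measurable _ that]) (use cell[OF p(1)] in simp)
    then show ?thesis unfolding all_step_kernels01_def using p(1) by blast
  qed
  ultimately show "\<exists>p\<ge>N. \<exists>\<kappa>. separating_cells p \<kappa> \<and>
      (\<forall>u. (\<forall>e\<in>vertex_pairs p. u e \<in> {0..1}) \<longrightarrow> edge_kernel p \<kappa> u \<in> all_step_kernels01 C)"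
    using p(2) by blast
qed

end

theorem theorem4p31:
  fixes k :: nat and x :: "nat \<Rightarrow> real"
  assumes "\<forall>i\<in>{1..k}. x i \<in> {0..1}"
    and "inj_on x {1..k}"
  shows "(\<forall>a b. series_radius k a > 0 \<and> series_radius k b > 0 \<and>
            (\<forall>f \<in> series_domain k a \<inter> series_domain k b. series_fun k x a f = series_fun k x b f) \<longrightarrow>
            (\<forall>n. \<forall>H\<in>mgraph_classes n k. a H = b H))
       \<and> (\<forall>a. series_radius k a > 0 \<longrightarrow>
            (\<forall>n. \<forall>f \<in> all_step_kernels01 left_open_cell \<union> all_step_kernels01 zero_closed_cell.
               gateaux_differentiable (series_fun k x a) n (\<lambda>_. 0) (\<lambda>_. f)))
       \<and> ((\<forall>i\<in>{1..k}. x i \<noteq> 0) \<longrightarrow>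
            recoverable_from_derivatives k x (all_step_kernels01 left_open_cell))
       \<and> recoverable_from_derivatives k x (all_step_kernels01 zero_closed_cell)"
proof -
  interpret unit_points k x
    using assms(1) by unfold_locales blast
  \<comment> \<open>Adding 0 to the first cell makes the family rich even if some
    \<open>x i = 0\<close>, so it also serves for uniqueness from the function alone.\<close>
  have zero_closed: "rich (all_step_kernels01 zero_closed_cell)"
    by (rule rich_all_step_kernels01[OF assms(2), of 1]) (simp_all add: zero_closed_cell_iff)
  have left_open: "rich (all_step_kernels01 left_open_cell)" if "\<forall>i\<in>{1..k}. x i \<noteq> 0"
    by (rule rich_all_step_kernels01[OF assms(2), of 0]) (use that in \<open>simp_all add: left_open_cell_iff\<close>)
  have sub: "all_step_kernels01 C \<subseteq> kernels01" for C
    by (auto simp: all_step_kernels01_def step_kernels01_def)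
  show ?thesis
  proof (intro conjI allI impI ballI)
    fix a b n H
    assume "series_radius k a > 0 \<and> series_radius k b > 0 \<and>
      (\<forall>f \<in> series_domain k a \<inter> series_domain k b. series_fun k x a f = series_fun k x b f)"
      and "H \<in> mgraph_classes n k"
    then show "a H = b H"
      using coefficients_determined_by_series_fun[OF zero_closed] by blast
  next
    fix a n f
    assume "series_radius k a > 0"
      and "f \<in> all_step_kernels01 left_open_cell \<union> all_step_kernels01 zero_closed_cell"
    then show "gateaux_differentiable (series_fun k x a) n (\<lambda>_. 0) (\<lambda>_. f)"
      using gateaux_series_fun(1) sub by blast
  qed (use recoverable_if_rich left_open zero_closed in blast)+
qed

end
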